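(* Let $R$ be a semiprime left Goldie ring. Then 1. $Q_l^s(R)=Q_{l,cl}(R)$. 2. $\mathfrak{l}^s_R=0$. 3. $T_l(R)=\mathcal{C}_R$.
   Context: Rings are associative with $1$ and nonzero. A multiplicative subset $S$ of $R$ is a submonoid of $(R,\cdot)$ with $1\in S$, $0\notin S$. It is a left Ore set if $Sr\cap Rs\neq\emptyset$ for all $r\in R$, $s\in S$; then $\mathrm{ass}(S):=\{r\in R\mid sr=0 \text{ for some } s\in S\}$ is an ideal. A left Ore set $S$ is a left denominator set if $rs=0$ with $r\in R$, $s\in S$ implies $r\in\mathrm{ass}(S)$. $\mathrm{Den}_l(R)$ is the set of left denominator sets of $R$; for $S\in\mathrm{Den}_l(R)$, $S^{-1}R=\{s^{-1}r\mid s\in S,r\in R\}$ is the left localization. $\mathrm{max.Den}_l(R)$ is the (non-empty) set of elements of $\mathrm{Den}_l(R)$ maximal under inclusion. $\mathcal{L}^s_l(R):=\bigcap_{S\in \mathrm{max.Den}_l(R)}S$. $T_l(R)$ is the union of all $S\in\mathrm{Den}_l(R)$ with $S\subseteq\mathcal{L}^s_l(R)$; it is the largest left denominator set of $R$ contained in $\mathcal{L}^s_l(R)$. $Q_l^s(R):=T_l(R)^{-1}R$ and $\mathfrak{l}^s_R:=\mathrm{ass}(T_l(R))$. $\mathcal{C}_R$ is the set of regular elements (non-zero-divisors) of $R$ and $Q_{l,cl}(R):=\mathcal{C}_R^{-1}R$ is the classical left quotient ring (it exists for semiprime left Goldie rings by Goldie's Theorem). A ring is left Goldie if it contains no infinite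 direct sum of nonzero left ideals and satisfies the ascending chain condition on left annihilators. *)

theory Defs
  imports "HOL-Algebra.Ideal_Product"
begin

section \<open>Semiprime left Goldie rings\<close>

definition left_ideal :: "'a set \<Rightarrow> ('a, 'b) ring_scheme \<Rightarrow> bool" where
  "left_ideal I R \<longleftrightarrow>
     additive_subgroup I R \<and> (\<forall>r\<in>carrier R. \<forall>x\<in>I. r \<otimes>\<^bsub>R\<^esub> x \<in> I)"

text \<open>The sum of the members of the (possibly infinite) set \<open>\<I>\<close> is direct. Since the left ideals
  of a direct family of nonzero left ideals are pairwise distinct, sets of left ideals
  are as general as indexed families.\<close>

definition direct_left_ideals :: "('a, 'b) ring_scheme \<Rightarrow> 'a set set \<Rightarrow> bool" where
  "direct_left_ideals R \<I> \<longleftrightarrow>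
     (\<forall>\<F> x. finite \<F> \<and> \<F> \<subseteq> \<I> \<and> (\<forall>I\<in>\<F>. x I \<in> I) \<and> finsum R x \<F> = \<zero>\<^bsub>R\<^esub>
        \<longrightarrow> (\<forall>I\<in>\<F>. x I = \<zero>\<^bsub>R\<^esub>))"

definition left_ann :: "('a, 'b) ring_scheme \<Rightarrow> 'a set \<Rightarrow> 'a set" where
  "left_ann R X = {r \<in> carrier R. \<forall>x\<in>X. r \<otimes>\<^bsub>R\<^esub> x = \<zero>\<^bsub>R\<^esub>}"

definition left_goldie :: "('a, 'b) ring_scheme \<Rightarrow> bool" where
  "left_goldie R \<longleftrightarrow>
     \<not> (\<exists>\<I>. infinite \<I> \<and> (\<forall>I\<in>\<I>. left_ideal I R \<and> I \<noteq> {\<zero>\<^bsub>R\<^esub>}) \<and> direct_left_ideals R \<I>) \<and>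
     (\<forall>A :: nat \<Rightarrow> 'a set.
        (\<forall>n. \<exists>X \<subseteq> carrier R. A n = left_ann R X) \<and> (\<forall>n. A n \<subseteq> A (Suc n))
          \<longrightarrow> (\<exists>n. \<forall>m\<ge>n. A m = A n))"

text \<open>No nonzero nilpotent two-sided ideals; the \<open>n\<close>-fold iterate below is the ideal power
  with exponent \<open>n + 1\<close>.\<close>

definition semiprime_ring :: "('a, 'b) ring_scheme \<Rightarrow> bool" where
  "semiprime_ring R \<longleftrightarrow>
     (\<forall>I n. ideal I R \<and> ((\<lambda>J. ideal_prod R J I) ^^ n) I = {\<zero>\<^bsub>R\<^esub>} \<longrightarrow> I = {\<zero>\<^bsub>R\<^esub>})"

definition regular_elems :: "('a, 'b) ring_scheme \<Rightarrow> 'a set" where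
  "regular_elems R =
     {c \<in> carrier R. \<forall>r\<in>carrier R.
        (c \<otimes>\<^bsub>R\<^esub> r = \<zero>\<^bsub>R\<^esub> \<longrightarrow> r = \<zero>\<^bsub>R\<^esub>) \<and> (r \<otimes>\<^bsub>R\<^esub> c = \<zero>\<^bsub>R\<^esub> \<longrightarrow> r = \<zero>\<^bsub>R\<^esub>)}"


section \<open>Left denominator sets\<close>

definition multiplicative_subset :: "('a, 'b) ring_scheme \<Rightarrow> 'a set \<Rightarrow> bool" where
  "multiplicative_subset R S \<longleftrightarrow> submonoid S R \<and> \<zero>\<^bsub>R\<^esub> \<notin> S"

definition left_ore_set :: "('a, 'b) ring_scheme \<Rightarrow> 'a set \<Rightarrow> bool" where
  "left_ore_set R S \<longleftrightarrow>
     multiplicative_subset R S \<and>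
     (\<forall>r\<in>carrier R. \<forall>s\<in>S. (\<lambda>s'. s' \<otimes>\<^bsub>R\<^esub> r) ` S \<inter> (\<lambda>r'. r' \<otimes>\<^bsub>R\<^esub> s) ` carrier R \<noteq> {})"

definition ass :: "('a, 'b) ring_scheme \<Rightarrow> 'a set \<Rightarrow> 'a set" where
  "ass R S = {r \<in> carrier R. \<exists>s\<in>S. s \<otimes>\<^bsub>R\<^esub> r = \<zero>\<^bsub>R\<^esub>}"

definition Den_l :: "('a, 'b) ring_scheme \<Rightarrow> 'a set set" where
  "Den_l R =
     {S. left_ore_set R S \<and>
         (\<forall>r\<in>carrier R. \<forall>s\<in>S. r \<otimes>\<^bsub>R\<^esub> s = \<zero>\<^bsub>R\<^esub> \<longrightarrow> r \<in> ass R S)}"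

definition max_Den_l :: "('a, 'b) ring_scheme \<Rightarrow> 'a set set" where
  "max_Den_l R = {S \<in> Den_l R. \<forall>S'\<in>Den_l R. S \<subseteq> S' \<longrightarrow> S' = S}"

definition L_s_l :: "('a, 'b) ring_scheme \<Rightarrow> 'a set" where
  "L_s_l R = \<Inter> (max_Den_l R)"

definition T_l :: "('a, 'b) ring_scheme \<Rightarrow> 'a set" where
  "T_l R = \<Union> {S \<in> Den_l R. S \<subseteq> L_s_l R}"


section \<open>Left localization\<close>

text \<open>A pair \<open>(s, r)\<close> stands for the left fraction \<open>s\<inverse> r\<close>. Two fractions are equal if they become
  equal after expansion to a common denominator.\<close>

definition frac_rel :: "('a, 'b) ring_scheme \<Rightarrow> 'a set \<Rightarrow> (('a \<times> 'a) \<times> ('a \<times> 'a)) set" where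
  "frac_rel R S =
     {((s, r), (t, q)) | s r t q.
        s \<in> S \<and> r \<in> carrier R \<and> t \<in> S \<and> q \<in> carrier R \<and>
        (\<exists>a\<in>carrier R. \<exists>b\<in>carrier R.
           a \<otimes>\<^bsub>R\<^esub> s \<in> S \<and> a \<otimes>\<^bsub>R\<^esub> s = b \<otimes>\<^bsub>R\<^esub> t \<and> a \<otimes>\<^bsub>R\<^esub> r = b \<otimes>\<^bsub>R\<^esub> q)}"

definition frac :: "('a, 'b) ring_scheme \<Rightarrow> 'a set \<Rightarrow> 'a \<Rightarrow> 'a \<Rightarrow> ('a \<times> 'a) set" where
  "frac R S s r = frac_rel R S `` {(s, r)}"

text \<open>The ring \<open>S\<inverse>R\<close>. Sums are formed with a common denominator. Products follow
  \<open>s\<inverse> r \<cdot> t\<inverse> q = s\<inverse> (v\<inverse> w) q = (v s)\<inverse> (w q)\<close>, where \<open>v r = w t\<close> by the left Ore condition.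
  Closing under \<open>frac_rel\<close> turns the set of all fractions computed in this way into a single
  equivalence class (lemmas \<open>add_frac\<close> and \<open>mult_frac\<close> below).\<close>

definition left_loc :: "('a, 'b) ring_scheme \<Rightarrow> 'a set \<Rightarrow> ('a \<times> 'a) set ring" where
  "left_loc R S =
     \<lparr> carrier = (S \<times> carrier R) // frac_rel R S,
       mult = (\<lambda>X Y. frac_rel R S ``
                 {(v \<otimes>\<^bsub>R\<^esub> s, w \<otimes>\<^bsub>R\<^esub> q) | v w s r t q.
                    (s, r) \<in> X \<and> (t, q) \<in> Y \<and> v \<in> S \<and> w \<in> carrier R \<and>
                    v \<otimes>\<^bsub>R\<^esub> r = w \<otimes>\<^bsub>R\<^esub> t}),
       one = frac R S \<one>\<^bsub>R\<^esub> \<one>\<^bsub>R\<^esub>,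
       zero = frac R S \<one>\<^bsub>R\<^esub> \<zero>\<^bsub>R\<^esub>,
       add = (\<lambda>X Y. frac_rel R S ``
                 {(u, r \<oplus>\<^bsub>R\<^esub> q) | u r q. (u, r) \<in> X \<and> (u, q) \<in> Y}) \<rparr>"

definition Q_l_s :: "('a, 'b) ring_scheme \<Rightarrow> ('a \<times> 'a) set ring" where
  "Q_l_s R = left_loc R (T_l R)"

definition l_s :: "('a, 'b) ring_scheme \<Rightarrow> 'a set" where
  "l_s R = ass R (T_l R)"

definition Q_l_cl :: "('a, 'b) ring_scheme \<Rightarrow> ('a \<times> 'a) set ring" where
  "Q_l_cl R = left_loc R (regular_elems R)"


section \<open>The localization at a left denominator set is a ring\<close>

locale left_denominator = ring R for R (structure) +
  fixes S
  assumes den: "S \<in> Den_l R"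
begin

lemma S_sub: "S \<subseteq> carrier R"
  using den by (auto simp: Den_l_def left_ore_set_def multiplicative_subset_def submonoid_def)

lemma S_carr [simp]: "s \<in> S \<Longrightarrow> s \<in> carrier R"
  using S_sub by blast

lemma S_mult [simp]: "s \<in> S \<Longrightarrow> t \<in> S \<Longrightarrow> s \<otimes> t \<in> S"
  using den by (auto simp: Den_l_def left_ore_set_def multiplicative_subset_def submonoid_def)

lemma S_one [simp]: "\<one> \<in> S"
  using den by (auto simp: Den_l_def left_ore_set_def multiplicative_subset_def submonoid_def)

lemma ore:
  assumes "r \<in> carrier R" "s \<in> S"
  obtains v w where "v \<in> S" "w \<in> carrier R" "v \<otimes> r = w \<otimes> s"
proof -
  have "(\<lambda>s'. s' \<otimes> r) ` S \<inter> (\<lambda>r'. r' \<otimes> s) ` carrier R \<noteq> {}"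
    using den assms by (auto simp: Den_l_def left_ore_set_def)
  then obtain z where "z \<in> (\<lambda>s'. s' \<otimes> r) ` S" "z \<in> (\<lambda>r'. r' \<otimes> s) ` carrier R"
    by blast
  then show ?thesis using that by auto
qed

lemma cancel:
  assumes "x \<in> carrier R" "y \<in> carrier R" "s \<in> S" "x \<otimes> s = y \<otimes> s"
  obtains z where "z \<in> S" "z \<otimes> x = z \<otimes> y"
proof -
  have "(x \<ominus> y) \<otimes> s = \<zero>"
    using assms by (simp add: minus_eq l_distr l_minus r_neg)
  then have "x \<ominus> y \<in> ass R S"
    using den assms by (auto simp: Den_l_def)
  then obtain z where z: "z \<in> S" "z \<otimes> (x \<ominus> y) = \<zero>"
    by (auto simp: ass_def)
  then have "z \<otimes> x \<ominus> z \<otimes> y = \<zero>"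
    using assms by (simp add: minus_eq r_distr r_minus)
  then have "z \<otimes> x = z \<otimes> y"
    using assms(1,2) z(1) minus_equality[of "z \<otimes> x" "\<ominus> (z \<otimes> y)"]
    by (simp add: minus_eq minus_minus)
  then show ?thesis using that z(1) by blast
qed

lemma mult_eq_extend:
  assumes "x \<otimes> a = y \<otimes> c" "x \<in> carrier R" "a \<in> carrier R" "y \<in> carrier R" "c \<in> carrier R"
    "u \<in> carrier R"
  shows "x \<otimes> (a \<otimes> u) = y \<otimes> (c \<otimes> u)"
  using assms by (metis m_assoc)

text \<open>Two multiples of \<open>s\<close> that lie in \<open>S\<close> have a common multiple.\<close>

lemma common:
  assumes "x \<in> carrier R" "y \<in> carrier R" "s \<in> S" "x \<otimes> s \<in> S" "y \<otimes> s \<in> S"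
  obtains a b where "a \<in> S" "b \<in> carrier R" "a \<otimes> x = b \<otimes> y"
proof -
  obtain v w where vw: "v \<in> S" "w \<in> carrier R" "v \<otimes> (x \<otimes> s) = w \<otimes> (y \<otimes> s)"
    using ore[of "x \<otimes> s" "y \<otimes> s"] assms by auto
  then have "(v \<otimes> x) \<otimes> s = (w \<otimes> y) \<otimes> s"
    using assms by (simp add: m_assoc)
  then obtain z where z: "z \<in> S" "z \<otimes> (v \<otimes> x) = z \<otimes> (w \<otimes> y)"
    using cancel[of "v \<otimes> x" "w \<otimes> y" s] assms vw by auto
  then have "(z \<otimes> v) \<otimes> x = (z \<otimes> w) \<otimes> y"
    using assms vw by (simp add: m_assoc)
  then show ?thesis using that[of "z \<otimes> v" "z \<otimes> w"] z vw by auto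
qed

lemma frac_relI:
  assumes "s \<in> S" "r \<in> carrier R" "t \<in> S" "q \<in> carrier R" "a \<in> carrier R" "b \<in> carrier R"
    "a \<otimes> s \<in> S" "a \<otimes> s = b \<otimes> t" "a \<otimes> r = b \<otimes> q"
  shows "((s, r), (t, q)) \<in> frac_rel R S"
  unfolding frac_rel_def using assms by blast

lemma frac_relE:
  assumes "((s, r), (t, q)) \<in> frac_rel R S"
  obtains a b where "s \<in> S" "r \<in> carrier R" "t \<in> S" "q \<in> carrier R" "a \<in> carrier R"
    "b \<in> carrier R" "a \<otimes> s \<in> S" "a \<otimes> s = b \<otimes> t" "b \<otimes> t \<in> S" "a \<otimes> r = b \<otimes> q"
proof -
  from assms obtain a b where *: "s \<in> S" "r \<in> carrier R" "t \<in> S" "q \<in> carrier R"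
    "a \<in> carrier R" "b \<in> carrier R" "a \<otimes> s \<in> S" "a \<otimes> s = b \<otimes> t" "a \<otimes> r = b \<otimes> q"
    unfolding frac_rel_def by blast
  from *(7,8) have "b \<otimes> t \<in> S" by simp
  with * show ?thesis by (intro that)
qed

lemma frac_rel_equiv: "equiv (S \<times> carrier R) (frac_rel R S)"
proof (rule equivI)
  show "frac_rel R S \<subseteq> (S \<times> carrier R) \<times> (S \<times> carrier R)"
    by (auto simp: frac_rel_def)
  show "refl_on (S \<times> carrier R) (frac_rel R S)"
    by (auto simp: refl_on_def intro!: frac_relI[where a = \<one> and b = \<one>])
  show "sym (frac_rel R S)"
  proof (rule symI, clarify)
    fix s r t q assume "((s, r), (t, q)) \<in> frac_rel R S"
    then show "((t, q), (s, r)) \<in> frac_rel R S"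
      by (elim frac_relE) (rule frac_relI, assumption+, auto)
  qed
  show "trans (frac_rel R S)"
  proof (rule transI, clarify)
    fix s r t q u p
    assume "((s, r), (t, q)) \<in> frac_rel R S" "((t, q), (u, p)) \<in> frac_rel R S"
    then obtain a b c d where ab: "s \<in> S" "r \<in> carrier R" "t \<in> S" "q \<in> carrier R"
      "a \<in> carrier R" "b \<in> carrier R" "a \<otimes> s \<in> S" "a \<otimes> s = b \<otimes> t" "b \<otimes> t \<in> S"
      "a \<otimes> r = b \<otimes> q"
      and cd: "u \<in> S" "p \<in> carrier R" "c \<in> carrier R" "d \<in> carrier R" "c \<otimes> t \<in> S"
      "c \<otimes> t = d \<otimes> u" "c \<otimes> q = d \<otimes> p"
      by (elim frac_relE)
    obtain x y where xy: "x \<in> S" "y \<in> carrier R" "x \<otimes> b = y \<otimes> c"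
      using common[of b c t] ab cd by auto
    have 1: "(x \<otimes> a) \<otimes> s = (y \<otimes> d) \<otimes> u"
    proof -
      have "(x \<otimes> a) \<otimes> s = (x \<otimes> b) \<otimes> t"
        using ab xy(1,2) by (simp add: m_assoc)
      also have "\<dots> = (y \<otimes> d) \<otimes> u"
        using ab cd xy mult_eq_extend[OF xy(3), of t] by (simp add: m_assoc)
      finally show ?thesis .
    qed
    have 2: "(x \<otimes> a) \<otimes> r = (y \<otimes> d) \<otimes> p"
    proof -
      have "(x \<otimes> a) \<otimes> r = (x \<otimes> b) \<otimes> q"
        using ab xy(1,2) by (simp add: m_assoc)
      also have "\<dots> = (y \<otimes> d) \<otimes> p"
        using ab cd xy mult_eq_extend[OF xy(3), of q] by (simp add: m_assoc)
      finally show ?thesis .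
    qed
    have "(x \<otimes> a) \<otimes> s \<in> S"
      using ab xy by (simp add: m_assoc)
    then show "((s, r), (u, p)) \<in> frac_rel R S"
      using 1 2 ab cd xy by (intro frac_relI[where a = "x \<otimes> a" and b = "y \<otimes> d"]) auto
  qed
qed

lemma frac_eq_iff:
  assumes "s \<in> S" "r \<in> carrier R" "t \<in> S" "q \<in> carrier R"
  shows "frac R S s r = frac R S t q \<longleftrightarrow> ((s, r), (t, q)) \<in> frac_rel R S"
  unfolding frac_def using eq_equiv_class_iff[OF frac_rel_equiv] assms by simp

lemma mem_frac: "(t, q) \<in> frac R S s r \<longleftrightarrow> ((s, r), (t, q)) \<in> frac_rel R S"
  by (simp add: frac_def)

lemma frac_self: "s \<in> S \<Longrightarrow> r \<in> carrier R \<Longrightarrow> (s, r) \<in> frac R S s r"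
  by (simp add: mem_frac flip: frac_eq_iff)

lemma mem_fracD:
  assumes "(t, q) \<in> frac R S s r"
  shows "t \<in> S" "q \<in> carrier R" "s \<in> S" "r \<in> carrier R" "frac R S t q = frac R S s r"
proof -
  have *: "((s, r), (t, q)) \<in> frac_rel R S" using assms by (simp add: mem_frac)
  then show c: "t \<in> S" "q \<in> carrier R" "s \<in> S" "r \<in> carrier R" by (auto elim: frac_relE)
  show "frac R S t q = frac R S s r" using frac_eq_iff[of s r t q] c * by simp
qed

lemma frac_expand:
  assumes "s \<in> S" "r \<in> carrier R" "a \<in> carrier R" "a \<otimes> s \<in> S"
  shows "frac R S (a \<otimes> s) (a \<otimes> r) = frac R S s r"
  using assms by (subst frac_eq_iff) (auto intro!: frac_relI[where a = \<one> and b = a])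

lemma frac_carrier [simp]: "s \<in> S \<Longrightarrow> r \<in> carrier R \<Longrightarrow> frac R S s r \<in> carrier (left_loc R S)"
  by (auto simp: left_loc_def frac_def intro: quotientI)

lemma frac_cases:
  assumes "X \<in> carrier (left_loc R S)"
  obtains s r where "s \<in> S" "r \<in> carrier R" "X = frac R S s r"
  using assms by (auto simp: left_loc_def frac_def elim!: quotientE)

lemma frac_eqE:
  assumes "s \<in> S" "r \<in> carrier R" "t \<in> S" "q \<in> carrier R" "frac R S s r = frac R S t q"
  obtains a b where "a \<in> carrier R" "b \<in> carrier R" "a \<otimes> s \<in> S" "a \<otimes> s = b \<otimes> t" "b \<otimes> t \<in> S"
    "a \<otimes> r = b \<otimes> q"
  using assms frac_eq_iff by (auto elim: frac_relE)

lemma Image_frac: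
  assumes "x \<in> A" "\<And>s r. (s, r) \<in> A \<Longrightarrow> s \<in> S \<and> r \<in> carrier R \<and> frac R S s r = F"
  shows "frac_rel R S `` A = F"
proof -
  have "frac_rel R S `` A = (\<Union>(s, r)\<in>A. frac R S s r)"
    by (auto simp: frac_def)
  also have "\<dots> = (\<Union>z\<in>A. F)"
    by (rule SUP_cong) (use assms(2) in \<open>auto split: prod.split\<close>)
  also have "\<dots> = F"
    using assms(1) by blast
  finally show ?thesis .
qed

lemma common_denominator:
  assumes "s \<in> S" "r \<in> carrier R" "t \<in> S" "q \<in> carrier R"
  obtains u a b where "u \<in> S" "a \<in> carrier R" "b \<in> carrier R" "u = a \<otimes> s" "u = b \<otimes> t"
    "frac R S s r = frac R S u (a \<otimes> r)" "frac R S t q = frac R S u (b \<otimes> q)"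
proof -
  obtain v w where vw: "v \<in> S" "w \<in> carrier R" "v \<otimes> s = w \<otimes> t"
    using ore[of s t] assms by auto
  have "v \<otimes> s \<in> S" "w \<otimes> t \<in> S" using vw assms S_mult[of v s] by auto
  then show ?thesis
    using that[of "v \<otimes> s" v w] vw assms frac_expand[of s r v] frac_expand[of t q w] by simp
qed

lemma frac_pair_cases:
  assumes "X \<in> carrier (left_loc R S)" "Y \<in> carrier (left_loc R S)"
  obtains u r q where "u \<in> S" "r \<in> carrier R" "q \<in> carrier R"
    "X = frac R S u r" "Y = frac R S u q"
proof -
  obtain s r t q where *: "s \<in> S" "r \<in> carrier R" "X = frac R S s r"
    "t \<in> S" "q \<in> carrier R" "Y = frac R S t q"
    using assms by (elim frac_cases) blast
  then obtain u a b where "u \<in> S" "a \<in> carrier R" "b \<in> carrier R"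
    "frac R S s r = frac R S u (a \<otimes> r)" "frac R S t q = frac R S u (b \<otimes> q)"
    using common_denominator[of s r t q] by metis
  with * show ?thesis using that[of u "a \<otimes> r" "b \<otimes> q"] by auto
qed

lemma add_welldef:
  assumes "u \<in> S" "r \<in> carrier R" "q \<in> carrier R" "u' \<in> S" "r' \<in> carrier R" "q' \<in> carrier R"
    and r: "frac R S u r = frac R S u' r'" and q: "frac R S u q = frac R S u' q'"
  shows "frac R S u (r \<oplus> q) = frac R S u' (r' \<oplus> q')"
proof -
  obtain a b where ab: "a \<in> carrier R" "b \<in> carrier R" "a \<otimes> u \<in> S" "a \<otimes> u = b \<otimes> u'"
    "b \<otimes> u' \<in> S" "a \<otimes> r = b \<otimes> r'"
    using assms frac_eqE[of u r u' r'] by metis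
  obtain c d where cd: "c \<in> carrier R" "d \<in> carrier R" "c \<otimes> u \<in> S" "c \<otimes> u = d \<otimes> u'"
    "d \<otimes> u' \<in> S" "c \<otimes> q = d \<otimes> q'"
    using assms frac_eqE[of u q u' q'] by metis
  obtain x y where xy: "x \<in> S" "y \<in> carrier R" "x \<otimes> a = y \<otimes> c"
    using common[of a c u] assms ab cd by auto
  have "(x \<otimes> b) \<otimes> u' = x \<otimes> (a \<otimes> u)"
    unfolding ab(4) using assms(4) ab(2) xy(1) by (simp add: m_assoc)
  also have "\<dots> = y \<otimes> (c \<otimes> u)"
    by (rule mult_eq_extend[OF xy(3)]) (use assms(1) ab(1) cd(1) xy(1,2) in simp_all)
  also have "\<dots> = (y \<otimes> d) \<otimes> u'"
    unfolding cd(4) using assms(4) cd(2) xy(2) by (simp add: m_assoc)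
  finally have bd: "(x \<otimes> b) \<otimes> u' = (y \<otimes> d) \<otimes> u'" .
  obtain z where z: "z \<in> S" "z \<otimes> (x \<otimes> b) = z \<otimes> (y \<otimes> d)"
    by (rule cancel[OF _ _ assms(4) bd]) (use ab(2) cd(2) xy(1,2) in simp_all)
  note C = assms(1-6) ab(1,2) cd(1,2) xy(1,2) z(1)
  have zx: "z \<otimes> x \<in> S" using C by simp
  have e1: "((z \<otimes> x) \<otimes> a) \<otimes> u = ((z \<otimes> x) \<otimes> b) \<otimes> u'"
    using C ab(4) by (simp add: m_assoc)
  have e2: "((z \<otimes> x) \<otimes> a) \<otimes> r = ((z \<otimes> x) \<otimes> b) \<otimes> r'"
    using C ab(6) by (simp add: m_assoc)
  have "((z \<otimes> x) \<otimes> a) \<otimes> q = z \<otimes> (x \<otimes> (a \<otimes> q))"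
    using C by (simp add: m_assoc)
  also have "x \<otimes> (a \<otimes> q) = y \<otimes> (c \<otimes> q)"
    by (rule mult_eq_extend[OF xy(3)]) (use C in simp_all)
  also have "z \<otimes> (y \<otimes> (c \<otimes> q)) = z \<otimes> ((y \<otimes> d) \<otimes> q')"
    unfolding cd(6) using C by (simp add: m_assoc)
  also have "\<dots> = z \<otimes> ((x \<otimes> b) \<otimes> q')"
    by (rule mult_eq_extend[OF z(2)[symmetric]]) (use C in simp_all)
  also have "\<dots> = ((z \<otimes> x) \<otimes> b) \<otimes> q'"
    using C by (simp add: m_assoc)
  finally have e3: "((z \<otimes> x) \<otimes> a) \<otimes> q = ((z \<otimes> x) \<otimes> b) \<otimes> q'" .
  have e4: "((z \<otimes> x) \<otimes> a) \<otimes> u \<in> S"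
    using C S_mult[OF zx ab(3)] by (simp add: m_assoc)
  have "((u, r \<oplus> q), (u', r' \<oplus> q')) \<in> frac_rel R S"
  proof (rule frac_relI[OF _ _ _ _ _ _ e4 e1])
    have "((z \<otimes> x) \<otimes> a) \<otimes> (r \<oplus> q) = ((z \<otimes> x) \<otimes> a) \<otimes> r \<oplus> ((z \<otimes> x) \<otimes> a) \<otimes> q"
      by (rule r_distr) (use C in simp_all)
    also have "\<dots> = ((z \<otimes> x) \<otimes> b) \<otimes> (r' \<oplus> q')"
      unfolding e2 e3 by (rule r_distr[symmetric]) (use C in simp_all)
    finally show "((z \<otimes> x) \<otimes> a) \<otimes> (r \<oplus> q) = ((z \<otimes> x) \<otimes> b) \<otimes> (r' \<oplus> q')" .
  qed (use C in simp_all)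
  then show ?thesis using assms(1-6) by (simp add: frac_eq_iff)
qed

lemma add_frac:
  assumes "u \<in> S" "r \<in> carrier R" "q \<in> carrier R"
  shows "frac R S u r \<oplus>\<^bsub>left_loc R S\<^esub> frac R S u q = frac R S u (r \<oplus> q)"
proof -
  have "frac_rel R S `` {(u', r' \<oplus> q') | u' r' q'.
          (u', r') \<in> frac R S u r \<and> (u', q') \<in> frac R S u q} = frac R S u (r \<oplus> q)"
    (is "_ `` ?A = _")
  proof (rule Image_frac)
    show "(u, r \<oplus> q) \<in> ?A" using assms frac_self by auto
  next
    fix s p assume "(s, p) \<in> ?A"
    then obtain r' q' where *: "(s, r') \<in> frac R S u r" "(s, q') \<in> frac R S u q" "p = r' \<oplus> q'"
      by auto
    show "s \<in> S \<and> p \<in> carrier R \<and> frac R S s p = frac R S u (r \<oplus> q)"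
      using mem_fracD[OF *(1)] mem_fracD[OF *(2)] *(3) assms add_welldef[of s r' q' u r q] by auto
  qed
  then show ?thesis unfolding left_loc_def ring.select_convs monoid.select_convs .
qed

lemma mult_indep:
  assumes "s \<in> S" "r \<in> carrier R" "t \<in> S" "q \<in> carrier R"
    and "v \<in> carrier R" "w \<in> carrier R" "v \<otimes> s \<in> S" "v \<otimes> r = w \<otimes> t"
    and "v' \<in> carrier R" "w' \<in> carrier R" "v' \<otimes> s \<in> S" "v' \<otimes> r = w' \<otimes> t"
  shows "frac R S (v \<otimes> s) (w \<otimes> q) = frac R S (v' \<otimes> s) (w' \<otimes> q)"
proof -
  obtain x y where xy: "x \<in> S" "y \<in> carrier R" "x \<otimes> v = y \<otimes> v'"
    using common[of v v' s] assms by auto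
  have "(x \<otimes> w) \<otimes> t = x \<otimes> (v \<otimes> r)"
    unfolding assms(8) using assms(3,6) xy(1) by (simp add: m_assoc)
  also have "\<dots> = y \<otimes> (v' \<otimes> r)"
    by (rule mult_eq_extend[OF xy(3)]) (use assms(2,5,9) xy(1,2) in simp_all)
  also have "\<dots> = (y \<otimes> w') \<otimes> t"
    unfolding assms(12) using assms(3,10) xy(2) by (simp add: m_assoc)
  finally have ww: "(x \<otimes> w) \<otimes> t = (y \<otimes> w') \<otimes> t" .
  obtain z where z: "z \<in> S" "z \<otimes> (x \<otimes> w) = z \<otimes> (y \<otimes> w')"
    by (rule cancel[OF _ _ assms(3) ww]) (use assms(6,10) xy(1,2) in simp_all)
  have zx: "z \<otimes> x \<in> S" using z xy by simp
  have e1: "(z \<otimes> x) \<otimes> (v \<otimes> s) = (z \<otimes> y) \<otimes> (v' \<otimes> s)"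
    using assms xy z mult_eq_extend[OF xy(3), of s] by (simp add: m_assoc)
  have e2: "(z \<otimes> x) \<otimes> (w \<otimes> q) = (z \<otimes> y) \<otimes> (w' \<otimes> q)"
    using assms xy z mult_eq_extend[OF z(2), of q] by (simp add: m_assoc)
  have "((v \<otimes> s, w \<otimes> q), (v' \<otimes> s, w' \<otimes> q)) \<in> frac_rel R S"
    using assms xy z(1) zx e1 e2 S_mult[OF zx assms(7)]
    by (intro frac_relI[where a = "z \<otimes> x" and b = "z \<otimes> y"]) auto
  then show ?thesis using assms by (simp add: frac_eq_iff)
qed

lemma mult_welldef_right:
  assumes "s \<in> S" "r \<in> carrier R" "t \<in> S" "q \<in> carrier R" "t' \<in> S" "q' \<in> carrier R"
    and "frac R S t q = frac R S t' q'"
    and "v \<in> carrier R" "w \<in> carrier R" "v \<otimes> s \<in> S" "v \<otimes> r = w \<otimes> t"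
    and "v' \<in> carrier R" "w' \<in> carrier R" "v' \<otimes> s \<in> S" "v' \<otimes> r = w' \<otimes> t'"
  shows "frac R S (v \<otimes> s) (w \<otimes> q) = frac R S (v' \<otimes> s) (w' \<otimes> q')"
proof -
  obtain a b where ab: "a \<in> carrier R" "b \<in> carrier R" "a \<otimes> t \<in> S" "a \<otimes> t = b \<otimes> t'"
    "b \<otimes> t' \<in> S" "a \<otimes> q = b \<otimes> q'"
    using assms frac_eqE[of t q t' q'] by metis
  obtain x y where xy: "x \<in> S" "y \<in> carrier R" "x \<otimes> r = y \<otimes> (a \<otimes> t)"
    using ore[of r "a \<otimes> t"] assms ab by auto
  have "frac R S (v \<otimes> s) (w \<otimes> q) = frac R S (x \<otimes> s) ((y \<otimes> a) \<otimes> q)"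
    using assms ab(1-3) xy by (intro mult_indep[of s r t]) (auto simp: m_assoc)
  also have "(y \<otimes> a) \<otimes> q = (y \<otimes> b) \<otimes> q'"
    using assms ab xy by (simp add: m_assoc)
  also have "frac R S (x \<otimes> s) ((y \<otimes> b) \<otimes> q') = frac R S (v' \<otimes> s) (w' \<otimes> q')"
    using assms ab xy by (intro mult_indep[of s r t']) (auto simp: m_assoc)
  finally show ?thesis .
qed

lemma mult_welldef:
  assumes "s \<in> S" "r \<in> carrier R" "s' \<in> S" "r' \<in> carrier R"
    and "t \<in> S" "q \<in> carrier R" "t' \<in> S" "q' \<in> carrier R"
    and "frac R S s r = frac R S s' r'" "frac R S t q = frac R S t' q'"
    and "v \<in> carrier R" "w \<in> carrier R" "v \<otimes> s \<in> S" "v \<otimes> r = w \<otimes> t"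
    and "v' \<in> carrier R" "w' \<in> carrier R" "v' \<otimes> s' \<in> S" "v' \<otimes> r' = w' \<otimes> t'"
  shows "frac R S (v \<otimes> s) (w \<otimes> q) = frac R S (v' \<otimes> s') (w' \<otimes> q')"
proof -
  obtain a b where ab: "a \<in> carrier R" "b \<in> carrier R" "a \<otimes> s \<in> S" "a \<otimes> s = b \<otimes> s'"
    "b \<otimes> s' \<in> S" "a \<otimes> r = b \<otimes> r'"
    using assms frac_eqE[of s r s' r'] by metis
  obtain x y where xy: "x \<in> S" "y \<in> carrier R" "x \<otimes> (a \<otimes> r) = y \<otimes> t"
    using ore[of "a \<otimes> r" t] assms ab by auto
  have "x \<otimes> (a \<otimes> s) \<in> S" using xy ab S_mult by blast
  then have "frac R S (v \<otimes> s) (w \<otimes> q) = frac R S ((x \<otimes> a) \<otimes> s) (y \<otimes> q)"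
    using assms ab(1-3) xy by (intro mult_indep[of s r t]) (auto simp: m_assoc)
  also have "(x \<otimes> a) \<otimes> s = (x \<otimes> b) \<otimes> s'"
    using assms ab xy by (simp add: m_assoc)
  also have "frac R S ((x \<otimes> b) \<otimes> s') (y \<otimes> q) = frac R S (v' \<otimes> s') (w' \<otimes> q')"
    using assms ab xy S_mult[OF xy(1) ab(5)]
    by (intro mult_welldef_right[of s' r' t q t' q']) (auto simp: m_assoc)
  finally show ?thesis .
qed

lemma mult_frac:
  assumes "s \<in> S" "r \<in> carrier R" "t \<in> S" "q \<in> carrier R"
    and "v \<in> carrier R" "w \<in> carrier R" "v \<otimes> s \<in> S" "v \<otimes> r = w \<otimes> t"
  shows "frac R S s r \<otimes>\<^bsub>left_loc R S\<^esub> frac R S t q = frac R S (v \<otimes> s) (w \<otimes> q)"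
proof -
  have "frac_rel R S `` {(v' \<otimes> s', w' \<otimes> q') | v' w' s' r' t' q'.
          (s', r') \<in> frac R S s r \<and> (t', q') \<in> frac R S t q \<and> v' \<in> S \<and> w' \<in> carrier R \<and>
          v' \<otimes> r' = w' \<otimes> t'} = frac R S (v \<otimes> s) (w \<otimes> q)"
    (is "_ `` ?A = _")
  proof -
    obtain x y where xy: "x \<in> S" "y \<in> carrier R" "x \<otimes> r = y \<otimes> t"
      using ore[of r t] assms by auto
    show ?thesis
    proof (rule Image_frac)
      show "(x \<otimes> s, y \<otimes> q) \<in> ?A" using assms xy frac_self by blast
    next
      fix u p assume "(u, p) \<in> ?A"
      then obtain v' w' s' r' t' q' where *: "(s', r') \<in> frac R S s r" "(t', q') \<in> frac R S t q"
        "v' \<in> S" "w' \<in> carrier R" "v' \<otimes> r' = w' \<otimes> t'" "u = v' \<otimes> s'" "p = w' \<otimes> q'"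
        by auto
      note d = mem_fracD[OF *(1)] mem_fracD[OF *(2)]
      have "frac R S u p = frac R S (v \<otimes> s) (w \<otimes> q)"
        unfolding *(6,7) by (rule mult_welldef[of s' r' s r t' q' t q]) (use * d assms in auto)
      then show "u \<in> S \<and> p \<in> carrier R \<and> frac R S u p = frac R S (v \<otimes> s) (w \<otimes> q)"
        using * d by auto
    qed
  qed
  then show ?thesis unfolding left_loc_def ring.select_convs monoid.select_convs .
qed

lemma zero_loc: "s \<in> S \<Longrightarrow> \<zero>\<^bsub>left_loc R S\<^esub> = frac R S s \<zero>"
  using frac_expand[of \<one> \<zero> s] by (simp add: left_loc_def)

lemma one_loc: "\<one>\<^bsub>left_loc R S\<^esub> = frac R S \<one> \<one>"
  by (simp add: left_loc_def)

lemma abelian_group_left_loc: "abelian_group (left_loc R S)"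
proof (rule abelian_groupI)
  fix X Y assume "X \<in> carrier (left_loc R S)" "Y \<in> carrier (left_loc R S)"
  then obtain u r q where *: "u \<in> S" "r \<in> carrier R" "q \<in> carrier R"
    "X = frac R S u r" "Y = frac R S u q"
    by (rule frac_pair_cases)
  then show "X \<oplus>\<^bsub>left_loc R S\<^esub> Y \<in> carrier (left_loc R S)"
    by (simp add: add_frac)
  show "X \<oplus>\<^bsub>left_loc R S\<^esub> Y = Y \<oplus>\<^bsub>left_loc R S\<^esub> X"
    using * by (simp add: add_frac a_comm)
next
  show "\<zero>\<^bsub>left_loc R S\<^esub> \<in> carrier (left_loc R S)"
    by (simp add: zero_loc[OF S_one])
next
  fix X assume "X \<in> carrier (left_loc R S)"
  then obtain s r where *: "s \<in> S" "r \<in> carrier R" "X = frac R S s r"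
    by (rule frac_cases)
  show "\<zero>\<^bsub>left_loc R S\<^esub> \<oplus>\<^bsub>left_loc R S\<^esub> X = X"
    using * by (simp add: zero_loc[of s] add_frac)
  show "\<exists>Y\<in>carrier (left_loc R S). Y \<oplus>\<^bsub>left_loc R S\<^esub> X = \<zero>\<^bsub>left_loc R S\<^esub>"
    using * by (intro bexI[of _ "frac R S s (\<ominus> r)"]) (simp_all add: zero_loc[of s] add_frac l_neg)
next
  fix X Y Z assume XYZ: "X \<in> carrier (left_loc R S)" "Y \<in> carrier (left_loc R S)"
    "Z \<in> carrier (left_loc R S)"
  obtain u r q where *: "u \<in> S" "r \<in> carrier R" "q \<in> carrier R"
    "X = frac R S u r" "Y = frac R S u q"
    using XYZ by (meson frac_pair_cases)
  obtain t p where Z: "t \<in> S" "p \<in> carrier R" "Z = frac R S t p"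
    using XYZ frac_cases by metis
  obtain x a b where x: "x \<in> S" "a \<in> carrier R" "b \<in> carrier R" "x = a \<otimes> u" "x = b \<otimes> t"
    "frac R S t p = frac R S x (b \<otimes> p)"
    using common_denominator[of u r t p] * Z by metis
  have "X = frac R S x (a \<otimes> r)" "Y = frac R S x (a \<otimes> q)" "Z = frac R S x (b \<otimes> p)"
    using * Z x frac_expand[of u r a] frac_expand[of u q a] by auto
  then show "X \<oplus>\<^bsub>left_loc R S\<^esub> Y \<oplus>\<^bsub>left_loc R S\<^esub> Z = X \<oplus>\<^bsub>left_loc R S\<^esub> (Y \<oplus>\<^bsub>left_loc R S\<^esub> Z)"
    using * Z x(1-3) by (simp add: add_frac a_assoc)
qed

lemma monoid_left_loc: "monoid (left_loc R S)"
proof (rule monoidI)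
  fix X Y assume XY: "X \<in> carrier (left_loc R S)" "Y \<in> carrier (left_loc R S)"
  obtain s r where X: "s \<in> S" "r \<in> carrier R" "X = frac R S s r"
    using XY frac_cases by metis
  obtain t q where Y: "t \<in> S" "q \<in> carrier R" "Y = frac R S t q"
    using XY frac_cases by metis
  obtain v w where vw: "v \<in> S" "w \<in> carrier R" "v \<otimes> r = w \<otimes> t"
    using ore[of r t] X Y by auto
  show "X \<otimes>\<^bsub>left_loc R S\<^esub> Y \<in> carrier (left_loc R S)"
    using X Y vw by (simp add: mult_frac[of s r t q v w])
next
  show "\<one>\<^bsub>left_loc R S\<^esub> \<in> carrier (left_loc R S)"
    by (simp add: one_loc)
next
  fix X Y Z assume XYZ: "X \<in> carrier (left_loc R S)" "Y \<in> carrier (left_loc R S)"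
    "Z \<in> carrier (left_loc R S)"
  obtain s r where X: "s \<in> S" "r \<in> carrier R" "X = frac R S s r"
    using XYZ frac_cases by metis
  obtain t q where Y: "t \<in> S" "q \<in> carrier R" "Y = frac R S t q"
    using XYZ frac_cases by metis
  obtain u p where Z: "u \<in> S" "p \<in> carrier R" "Z = frac R S u p"
    using XYZ frac_cases by metis
  obtain v w where vw: "v \<in> S" "w \<in> carrier R" "v \<otimes> q = w \<otimes> u"
    using ore[of q u] Y Z by auto
  obtain x y where xy: "x \<in> S" "y \<in> carrier R" "x \<otimes> r = y \<otimes> (v \<otimes> t)"
    using ore[of r "v \<otimes> t"] X Y vw by auto
  have YZ: "Y \<otimes>\<^bsub>left_loc R S\<^esub> Z = frac R S (v \<otimes> t) (w \<otimes> p)"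
    using Y Z vw by (simp add: mult_frac[of t q u p v w])
  have "X \<otimes>\<^bsub>left_loc R S\<^esub> (Y \<otimes>\<^bsub>left_loc R S\<^esub> Z) = frac R S (x \<otimes> s) (y \<otimes> (w \<otimes> p))"
    unfolding YZ X(3) by (rule mult_frac) (use X(1,2) Y(1) Z(2) vw xy in auto)
  moreover have XY: "X \<otimes>\<^bsub>left_loc R S\<^esub> Y = frac R S (x \<otimes> s) ((y \<otimes> v) \<otimes> q)"
    unfolding X(3) Y(3) by (rule mult_frac) (use X(1,2) Y(1,2) vw(1) xy in \<open>auto simp: m_assoc\<close>)
  have "(X \<otimes>\<^bsub>left_loc R S\<^esub> Y) \<otimes>\<^bsub>left_loc R S\<^esub> Z = frac R S (\<one> \<otimes> (x \<otimes> s)) ((y \<otimes> w) \<otimes> p)"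
    unfolding XY Z(3)
    by (rule mult_frac) (use X(1,2) Y(1,2) Z(1,2) vw xy(1,2) in \<open>auto simp: m_assoc\<close>)
  ultimately show "X \<otimes>\<^bsub>left_loc R S\<^esub> Y \<otimes>\<^bsub>left_loc R S\<^esub> Z
      = X \<otimes>\<^bsub>left_loc R S\<^esub> (Y \<otimes>\<^bsub>left_loc R S\<^esub> Z)"
    using X(1) Z(2) vw(2) xy(1,2) by (simp add: m_assoc)
next
  fix X assume "X \<in> carrier (left_loc R S)"
  then obtain s r where X: "s \<in> S" "r \<in> carrier R" "X = frac R S s r"
    by (rule frac_cases)
  show "\<one>\<^bsub>left_loc R S\<^esub> \<otimes>\<^bsub>left_loc R S\<^esub> X = X"
    using X by (simp add: one_loc mult_frac[of \<one> \<one> s r s \<one>])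
  show "X \<otimes>\<^bsub>left_loc R S\<^esub> \<one>\<^bsub>left_loc R S\<^esub> = X"
    using X by (simp add: one_loc mult_frac[of s r \<one> \<one> \<one> r])
qed

theorem ring_left_loc: "ring (left_loc R S)"
proof (rule ringI[OF abelian_group_left_loc monoid_left_loc])
  fix X Y Z assume XYZ: "X \<in> carrier (left_loc R S)" "Y \<in> carrier (left_loc R S)"
    "Z \<in> carrier (left_loc R S)"
  obtain s r q where XY: "s \<in> S" "r \<in> carrier R" "q \<in> carrier R"
    "X = frac R S s r" "Y = frac R S s q"
    using XYZ by (meson frac_pair_cases)
  obtain u p where Z: "u \<in> S" "p \<in> carrier R" "Z = frac R S u p"
    using XYZ frac_cases by metis
  show "(X \<oplus>\<^bsub>left_loc R S\<^esub> Y) \<otimes>\<^bsub>left_loc R S\<^esub> Z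
      = X \<otimes>\<^bsub>left_loc R S\<^esub> Z \<oplus>\<^bsub>left_loc R S\<^esub> Y \<otimes>\<^bsub>left_loc R S\<^esub> Z"
  proof -
    obtain v w where vw: "v \<in> S" "w \<in> carrier R" "v \<otimes> r = w \<otimes> u"
      using ore[of r u] XY Z by auto
    obtain x y where xy: "x \<in> S" "y \<in> carrier R" "x \<otimes> (v \<otimes> q) = y \<otimes> u"
      using ore[of "v \<otimes> q" u] XY Z vw by auto
    let ?V = "x \<otimes> v"
    have V: "?V \<in> S" "?V \<otimes> s \<in> S" "?V \<otimes> r = (x \<otimes> w) \<otimes> u" "?V \<otimes> q = y \<otimes> u"
      using XY Z vw xy by (simp_all add: m_assoc)
    have 1: "X \<otimes>\<^bsub>left_loc R S\<^esub> Z = frac R S (?V \<otimes> s) ((x \<otimes> w) \<otimes> p)"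
      unfolding XY(4) Z(3) by (rule mult_frac) (use XY(1,2) Z(1,2) vw xy(1) V in auto)
    have 2: "Y \<otimes>\<^bsub>left_loc R S\<^esub> Z = frac R S (?V \<otimes> s) (y \<otimes> p)"
      unfolding XY(5) Z(3) by (rule mult_frac) (use XY(1,3) Z(1,2) xy(2) V in auto)
    have 3: "X \<oplus>\<^bsub>left_loc R S\<^esub> Y = frac R S s (r \<oplus> q)"
      using XY by (simp add: add_frac)
    have "(X \<oplus>\<^bsub>left_loc R S\<^esub> Y) \<otimes>\<^bsub>left_loc R S\<^esub> Z = frac R S (?V \<otimes> s) ((x \<otimes> w \<oplus> y) \<otimes> p)"
      unfolding 3 Z(3)
      by (rule mult_frac) (use XY(1-3) Z(1,2) vw(2) xy(1,2) V in \<open>auto simp: r_distr l_distr\<close>)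
    then show ?thesis
      unfolding 1 2 using XY Z vw xy(1,2) V by (simp add: add_frac l_distr)
  qed
  show "Z \<otimes>\<^bsub>left_loc R S\<^esub> (X \<oplus>\<^bsub>left_loc R S\<^esub> Y)
      = Z \<otimes>\<^bsub>left_loc R S\<^esub> X \<oplus>\<^bsub>left_loc R S\<^esub> Z \<otimes>\<^bsub>left_loc R S\<^esub> Y"
  proof -
    obtain v w where vw: "v \<in> S" "w \<in> carrier R" "v \<otimes> p = w \<otimes> s"
      using ore[of p s] XY Z by auto
    show ?thesis
      using XY Z vw
      by (simp add: add_frac mult_frac[of u p s _ v w] r_distr)
  qed
qed

text \<open>The canonical homomorphism, with its kernel, and the representation of fractions.\<close>

lemma loc_hom: "frac R S \<one> \<in> ring_hom R (left_loc R S)"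
  by (rule ring_hom_memI)
     (simp_all add: one_loc add_frac mult_frac[of \<one> _ \<one> _ \<one>])

lemma loc_hom_kernel:
  assumes "r \<in> carrier R"
  shows "frac R S \<one> r = \<zero>\<^bsub>left_loc R S\<^esub> \<longleftrightarrow> r \<in> ass R S"
proof
  assume "frac R S \<one> r = \<zero>\<^bsub>left_loc R S\<^esub>"
  then obtain a b where "a \<in> carrier R" "b \<in> carrier R" "a \<otimes> \<one> \<in> S" "a \<otimes> r = b \<otimes> \<zero>"
    using assms frac_eqE[of \<one> r \<one> \<zero>] by (metis S_one zero_closed zero_loc)
  then show "r \<in> ass R S" using assms by (auto simp: ass_def)
next
  assume "r \<in> ass R S"
  then obtain s where "s \<in> S" "s \<otimes> r = \<zero>" by (auto simp: ass_def)
  then show "frac R S \<one> r = \<zero>\<^bsub>left_loc R S\<^esub>"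
    using assms frac_expand[of \<one> r s] by (simp add: zero_loc[of s])
qed

lemma loc_inverse:
  assumes "s \<in> S"
  shows "frac R S s \<one> \<otimes>\<^bsub>left_loc R S\<^esub> frac R S \<one> s = \<one>\<^bsub>left_loc R S\<^esub>"
    and "frac R S \<one> s \<otimes>\<^bsub>left_loc R S\<^esub> frac R S s \<one> = \<one>\<^bsub>left_loc R S\<^esub>"
proof -
  have "frac R S s \<one> \<otimes>\<^bsub>left_loc R S\<^esub> frac R S \<one> s = frac R S (s \<otimes> \<one>) (s \<otimes> \<one>)"
    using assms mult_frac[of s \<one> \<one> s \<one> \<one>] by simp
  then show "frac R S s \<one> \<otimes>\<^bsub>left_loc R S\<^esub> frac R S \<one> s = \<one>\<^bsub>left_loc R S\<^esub>"
    using assms frac_expand[of \<one> \<one> s] by (simp add: one_loc)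
  show "frac R S \<one> s \<otimes>\<^bsub>left_loc R S\<^esub> frac R S s \<one> = \<one>\<^bsub>left_loc R S\<^esub>"
    using assms by (simp add: one_loc mult_frac[of \<one> s s \<one> \<one> \<one>])
qed

lemma frac_eq_inverse_mult:
  assumes "s \<in> S" "r \<in> carrier R"
  shows "frac R S s r = frac R S s \<one> \<otimes>\<^bsub>left_loc R S\<^esub> frac R S \<one> r"
  using assms by (simp add: mult_frac[of s \<one> \<one> r \<one> \<one>])

end

section \<open>The largest left denominator set inside all maximal ones\<close>

inductive_set mgen :: "('a, 'b) ring_scheme \<Rightarrow> 'a set \<Rightarrow> 'a set" for R and G where
  one: "\<one>\<^bsub>R\<^esub> \<in> mgen R G"
| step: "m \<in> mgen R G \<Longrightarrow> g \<in> G \<Longrightarrow> m \<otimes>\<^bsub>R\<^esub> g \<in> mgen R G"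

context ring
begin

lemma Den_l_iff:
  "S \<in> Den_l R \<longleftrightarrow> S \<subseteq> carrier R \<and> \<one> \<in> S \<and> (\<forall>s\<in>S. \<forall>t\<in>S. s \<otimes> t \<in> S) \<and> \<zero> \<notin> S \<and>
     (\<forall>r\<in>carrier R. \<forall>s\<in>S. \<exists>s'\<in>S. \<exists>r'\<in>carrier R. s' \<otimes> r = r' \<otimes> s) \<and>
     (\<forall>r\<in>carrier R. \<forall>s\<in>S. r \<otimes> s = \<zero> \<longrightarrow> (\<exists>t\<in>S. t \<otimes> r = \<zero>))"
proof -
  have 1: "(\<lambda>s'. s' \<otimes> r) ` S \<inter> (\<lambda>r'. r' \<otimes> s) ` carrier R \<noteq> {}
      \<longleftrightarrow> (\<exists>s'\<in>S. \<exists>r'\<in>carrier R. s' \<otimes> r = r' \<otimes> s)" for r s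
    by blast
  have 2: "submonoid S R \<longleftrightarrow> S \<subseteq> carrier R \<and> \<one> \<in> S \<and> (\<forall>s\<in>S. \<forall>t\<in>S. s \<otimes> t \<in> S)"
    by (auto simp: submonoid_def)
  show ?thesis
    unfolding Den_l_def mem_Collect_eq left_ore_set_def multiplicative_subset_def 1 2 ass_def
    by auto
qed

lemma singleton_one_Den_l: "\<one> \<noteq> \<zero> \<Longrightarrow> {\<one>} \<in> Den_l R"
  by (auto simp: Den_l_iff)

lemma directed_Union_Den_l:
  assumes "\<C> \<noteq> {}" "\<C> \<subseteq> Den_l R"
    and dir: "\<And>A B. A \<in> \<C> \<Longrightarrow> B \<in> \<C> \<Longrightarrow> \<exists>C\<in>\<C>. A \<union> B \<subseteq> C"
  shows "\<Union>\<C> \<in> Den_l R"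
  unfolding Den_l_iff
proof (intro conjI ballI impI)
  show "\<Union>\<C> \<subseteq> carrier R" using assms(2) unfolding Den_l_iff subset_iff by blast
  show "\<one> \<in> \<Union>\<C>" using assms(1,2) by (auto simp: Den_l_iff)
  show "\<zero> \<notin> \<Union>\<C>" using assms(2) by (auto simp: Den_l_iff)
next
  fix s t assume "s \<in> \<Union>\<C>" "t \<in> \<Union>\<C>"
  then obtain C where "C \<in> \<C>" "s \<in> C" "t \<in> C"
    using dir by (meson Un_subset_iff UnionE subsetD)
  moreover from this have "C \<in> Den_l R" using assms(2) by blast
  ultimately have "s \<otimes> t \<in> C" by (simp add: Den_l_iff)
  then show "s \<otimes> t \<in> \<Union>\<C>" using \<open>C \<in> \<C>\<close> by blast
next
  fix r s assume "r \<in> carrier R" "s \<in> \<Union>\<C>"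
  then obtain C where C: "C \<in> \<C>" "s \<in> C" "C \<in> Den_l R" using assms(2) by blast
  then have "\<exists>s'\<in>C. \<exists>r'\<in>carrier R. s' \<otimes> r = r' \<otimes> s"
    using \<open>r \<in> carrier R\<close> unfolding Den_l_iff by blast
  then show "\<exists>s'\<in>\<Union>\<C>. \<exists>r'\<in>carrier R. s' \<otimes> r = r' \<otimes> s" using C by blast
  assume "r \<otimes> s = \<zero>"
  then have "\<exists>t\<in>C. t \<otimes> r = \<zero>"
    using C \<open>r \<in> carrier R\<close> unfolding Den_l_iff by blast
  then show "\<exists>t\<in>\<Union>\<C>. t \<otimes> r = \<zero>" using C by blast
qed

lemma ex_max_Den_l:
  assumes "S \<in> Den_l R"
  obtains M where "M \<in> max_Den_l R" "S \<subseteq> M"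
proof -
  define A where "A = {T \<in> Den_l R. S \<subseteq> T}"
  have ne: "A \<noteq> {}" using assms by (auto simp: A_def)
  have un: "\<Union>\<C> \<in> A" if C: "\<C> \<noteq> {}" "subset.chain A \<C>" for \<C>
  proof -
    have sub: "\<C> \<subseteq> A" using C(2) by (simp add: subset.chain_def)
    have "\<exists>E\<in>\<C>. B \<union> D \<subseteq> E" if "B \<in> \<C>" "D \<in> \<C>" for B D
    proof -
      have "B \<subseteq> D \<or> D \<subseteq> B" using C(2) that unfolding subset.chain_def by blast
      then show ?thesis using that by blast
    qed
    moreover have "\<C> \<subseteq> Den_l R" using sub by (auto simp: A_def)
    ultimately have "\<Union>\<C> \<in> Den_l R"
      using C(1) by (intro directed_Union_Den_l)
    moreover have "S \<subseteq> \<Union>\<C>" using C(1) sub unfolding A_def by blast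
    ultimately show ?thesis by (simp add: A_def)
  qed
  have "\<exists>M\<in>A. \<forall>X\<in>A. M \<subseteq> X \<longrightarrow> X = M"
    using subset_Zorn_nonempty[OF ne un] .
  then obtain M where M: "M \<in> A" and max: "\<forall>X\<in>A. M \<subseteq> X \<longrightarrow> X = M" ..
  have "M \<in> max_Den_l R"
    unfolding max_Den_l_def
  proof (intro CollectI conjI ballI impI)
    fix X assume "X \<in> Den_l R" "M \<subseteq> X"
    then show "X = M" using M max by (auto simp: A_def)
  next
    show "M \<in> Den_l R" using M by (simp add: A_def)
  qed
  moreover have "S \<subseteq> M" using M by (simp add: A_def)
  ultimately show ?thesis by (rule that)
qed

lemma max_Den_l_nonempty: "\<one> \<noteq> \<zero> \<Longrightarrow> max_Den_l R \<noteq> {}"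
  by (metis singleton_one_Den_l ex_max_Den_l empty_iff)

lemma mgen_carrier: "G \<subseteq> carrier R \<Longrightarrow> m \<in> mgen R G \<Longrightarrow> m \<in> carrier R"
  by (erule mgen.induct) auto

lemma mgen_incl: "G \<subseteq> carrier R \<Longrightarrow> G \<subseteq> mgen R G"
proof
  fix g assume "G \<subseteq> carrier R" "g \<in> G"
  then show "g \<in> mgen R G" using mgen.step[OF mgen.one[of R G], of g] by (simp add: subsetD)
qed

lemma mgen_mult:
  assumes "G \<subseteq> carrier R" "m \<in> mgen R G" "n \<in> mgen R G"
  shows "m \<otimes> n \<in> mgen R G"
  using assms(3)
proof induction
  case one
  then show ?case using assms mgen_carrier by simp
next
  case (step k g)
  have "m \<otimes> (k \<otimes> g) = (m \<otimes> k) \<otimes> g"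
    using assms step mgen_carrier by (simp add: m_assoc subsetD)
  then show ?case using step by (simp add: mgen.step)
qed

lemma mgen_Den_l:
  assumes S: "S \<in> Den_l R" "S' \<in> Den_l R" and z: "\<zero> \<notin> mgen R (S \<union> S')"
  shows "mgen R (S \<union> S') \<in> Den_l R"
proof -
  let ?G = "S \<union> S'"
  have G: "?G \<subseteq> carrier R" using S by (simp add: Den_l_iff)
  have ore: "\<exists>s'\<in>?G. \<exists>r'\<in>carrier R. s' \<otimes> r = r' \<otimes> s" if "r \<in> carrier R" "s \<in> ?G" for r s
    using S that unfolding Den_l_iff by blast
  have rev: "\<exists>t\<in>?G. t \<otimes> r = \<zero>" if "r \<in> carrier R" "s \<in> ?G" "r \<otimes> s = \<zero>" for r s
    using S that unfolding Den_l_iff by blast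
  have 1: "\<exists>m'\<in>mgen R ?G. \<exists>r'\<in>carrier R. m' \<otimes> r = r' \<otimes> m"
    if "m \<in> mgen R ?G" "r \<in> carrier R" for m r
    using that
  proof (induction arbitrary: r)
    case one
    then show ?case by (intro bexI[of _ \<one>] bexI[of _ r]) (auto intro: mgen.one)
  next
    case (step m g)
    obtain g' r1 where g': "g' \<in> ?G" "r1 \<in> carrier R" "g' \<otimes> r = r1 \<otimes> g"
      using ore step by blast
    obtain m' r2 where m': "m' \<in> mgen R ?G" "r2 \<in> carrier R" "m' \<otimes> r1 = r2 \<otimes> m"
      using step.IH g' by blast
    have c: "g \<in> carrier R" "g' \<in> carrier R" "m \<in> carrier R" "m' \<in> carrier R"
      using G step g' m' mgen_carrier[OF G] by blast+
    have "(m' \<otimes> g') \<otimes> r = m' \<otimes> (g' \<otimes> r)" using c step by (simp add: m_assoc)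
    also have "\<dots> = (m' \<otimes> r1) \<otimes> g" unfolding g'(3) using c g' by (simp add: m_assoc)
    also have "\<dots> = r2 \<otimes> (m \<otimes> g)" unfolding m'(3) using c m'(2) by (simp add: m_assoc)
    finally show ?case using mgen.step[OF m'(1) g'(1)] m'(2) by blast
  qed
  have 2: "\<exists>t\<in>mgen R ?G. t \<otimes> r = \<zero>"
    if "m \<in> mgen R ?G" "r \<in> carrier R" "r \<otimes> m = \<zero>" for m r
    using that
  proof (induction arbitrary: r)
    case one
    then show ?case by (intro bexI[of _ \<one>]) (auto intro: mgen.one)
  next
    case (step m g)
    have c: "g \<in> carrier R" "m \<in> carrier R" using G step mgen_carrier[OF G] by blast+
    have "(r \<otimes> m) \<otimes> g = \<zero>" using step.prems c by (simp add: m_assoc)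
    then obtain t where t: "t \<in> ?G" "t \<otimes> (r \<otimes> m) = \<zero>"
      using rev[of "r \<otimes> m" g] step c by auto
    have tc: "t \<in> carrier R" using t G by blast
    then have "(t \<otimes> r) \<otimes> m = \<zero>" using t c step.prems by (simp add: m_assoc)
    then obtain n where n: "n \<in> mgen R ?G" "n \<otimes> (t \<otimes> r) = \<zero>"
      using step.IH[of "t \<otimes> r"] tc step.prems by auto
    then have "(n \<otimes> t) \<otimes> r = \<zero>"
      using tc step.prems mgen_carrier[OF G n(1)] by (simp add: m_assoc)
    then show ?case using mgen.step[OF n(1) t(1)] by blast
  qed
  show ?thesis
    unfolding Den_l_iff
  proof (intro conjI ballI impI)
    show "mgen R ?G \<subseteq> carrier R" using mgen_carrier[OF G] by blast
    show "\<one> \<in> mgen R ?G" by (rule mgen.one)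
    show "\<zero> \<notin> mgen R ?G" by (rule z)
  qed (use 1 2 mgen_mult[OF G] in simp_all)
qed

theorem T_l_Den_l:
  assumes "\<one> \<noteq> \<zero>"
  shows "T_l R \<in> Den_l R"
  unfolding T_l_def
proof (rule directed_Union_Den_l)
  obtain M where M: "M \<in> max_Den_l R" using max_Den_l_nonempty assms by blast
  have D: "N \<in> Den_l R" if "N \<in> max_Den_l R" for N
    using that by (simp add: max_Den_l_def)
  have L: "\<zero> \<notin> L_s_l R" "\<one> \<in> L_s_l R"
    using M D by (auto simp: L_s_l_def Den_l_iff)
  have Lm: "s \<otimes> t \<in> L_s_l R" if "s \<in> L_s_l R" "t \<in> L_s_l R" for s t
    unfolding L_s_l_def
  proof
    fix N assume N: "N \<in> max_Den_l R"
    then have "s \<in> N" "t \<in> N" using that by (auto simp: L_s_l_def)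
    then show "s \<otimes> t \<in> N" using D[OF N] by (simp add: Den_l_iff)
  qed
  show "{S \<in> Den_l R. S \<subseteq> L_s_l R} \<noteq> {}"
    using singleton_one_Den_l[OF assms] L(2) by blast
  fix A B assume AB: "A \<in> {S \<in> Den_l R. S \<subseteq> L_s_l R}" "B \<in> {S \<in> Den_l R. S \<subseteq> L_s_l R}"
  have sub: "mgen R (A \<union> B) \<subseteq> L_s_l R"
  proof
    fix m assume "m \<in> mgen R (A \<union> B)"
    then show "m \<in> L_s_l R"
    proof induction
      case one
      show ?case by (rule L(2))
    next
      case (step m g)
      then have "g \<in> L_s_l R" using AB by blast
      with step.IH show ?case by (rule Lm)
    qed
  qed
  have "mgen R (A \<union> B) \<in> Den_l R"
    using mgen_Den_l[of A B] AB sub L(1) by blast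
  moreover have "A \<union> B \<subseteq> mgen R (A \<union> B)"
    using AB by (intro mgen_incl) (auto simp: Den_l_iff)
  ultimately show "\<exists>C\<in>{S \<in> Den_l R. S \<subseteq> L_s_l R}. A \<union> B \<subseteq> C"
    using sub by blast
qed auto

end

end

theory Submission
  imports Defs
begin

text \<open>By Goldie's theorem every essential left ideal contains a regular element, so the set \<open>C\<close> of
  regular elements is a left denominator set. It lies in every maximal left denominator set, because
  multiplication by a regular element cannot produce new zero products; hence \<open>C \<subseteq> T\<close>, where \<open>T\<close> is
  the largest left denominator set inside all maximal ones. Conversely, suppose that \<open>I = ass T\<close> is
  nonzero and let \<open>J\<close> be its annihilator. Then \<open>C + J\<close> is a left denominator set, and it meets \<open>I\<close>
  since \<open>I + J\<close> is essential. A maximal left denominator set above \<open>C + J\<close> contains \<open>T\<close> as well as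
  some \<open>i \<in> I\<close>, and \<open>t i = 0\<close> for some \<open>t \<in> T\<close>, which is impossible. So \<open>ass T = 0\<close>, which means that
  \<open>T\<close> consists of regular elements.\<close>

section \<open>Left ideals and annihilators\<close>

text \<open>Equivalently, \<open>R a\<close> meets the left annihilator of \<open>a\<close> trivially.\<close>

definition (in ring) ann_stable :: "'a \<Rightarrow> bool" where
  "ann_stable a \<longleftrightarrow> (\<forall>x\<in>carrier R. x \<otimes> a \<otimes> a = \<zero> \<longrightarrow> x \<otimes> a = \<zero>)"

definition (in ring) essential :: "'a set \<Rightarrow> bool" where
  "essential E \<longleftrightarrow> left_ideal E R \<and> (\<forall>K. left_ideal K R \<longrightarrow> E \<inter> K = {\<zero>} \<longrightarrow> K = {\<zero>})"

context ring
begin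

lemma left_idealI:
  assumes "I \<subseteq> carrier R" "\<zero> \<in> I"
    and "\<And>x y. x \<in> I \<Longrightarrow> y \<in> I \<Longrightarrow> x \<oplus> y \<in> I"
    and "\<And>r x. r \<in> carrier R \<Longrightarrow> x \<in> I \<Longrightarrow> r \<otimes> x \<in> I"
  shows "left_ideal I R"
proof -
  have "\<ominus> x \<in> I" if "x \<in> I" for x
    using assms(4)[of "\<ominus> \<one>" x] that assms(1) by (simp add: l_minus subset_iff)
  then have "additive_subgroup I R"
    using assms(1-3) by (intro additive_subgroup.intro add.subgroupI) (auto simp: a_inv_def)
  then show ?thesis using assms(4) by (simp add: left_ideal_def)
qed

lemma left_idealD:
  assumes "left_ideal I R"
  shows "I \<subseteq> carrier R" "\<zero> \<in> I" "x \<in> I \<Longrightarrow> y \<in> I \<Longrightarrow> x \<oplus> y \<in> I"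
    "x \<in> I \<Longrightarrow> \<ominus> x \<in> I" "r \<in> carrier R \<Longrightarrow> x \<in> I \<Longrightarrow> r \<otimes> x \<in> I"
  using assms
  by (auto simp: left_ideal_def additive_subgroup.a_Hcarr additive_subgroup.zero_closed
      additive_subgroup.a_closed additive_subgroup.a_inv_closed)

lemma left_ideal_nonzeroE:
  assumes "left_ideal I R" "I \<noteq> {\<zero>}"
  obtains x where "x \<in> I" "x \<in> carrier R" "x \<noteq> \<zero>"
proof -
  have "\<exists>x\<in>I. x \<noteq> \<zero>" using assms(2) left_idealD(2)[OF assms(1)] by blast
  then show ?thesis using that left_idealD(1)[OF assms(1)] by blast
qed

lemma left_ideal_Int: "left_ideal I R \<Longrightarrow> left_ideal J R \<Longrightarrow> left_ideal (I \<inter> J) R"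
  by (rule left_idealI) (auto simp: left_idealD dest: left_idealD(1))

lemma left_ideal_mult_right:
  assumes "left_ideal K R" "a \<in> carrier R"
  shows "left_ideal ((\<lambda>x. x \<otimes> a) ` K) R"
proof (rule left_idealI)
  note K = left_idealD[OF assms(1)]
  show "(\<lambda>x. x \<otimes> a) ` K \<subseteq> carrier R" using K(1) assms(2) by auto
  show "\<zero> \<in> (\<lambda>x. x \<otimes> a) ` K" using K(2) assms(2) by (intro image_eqI[of _ _ \<zero>]) auto
  fix x y assume "x \<in> (\<lambda>x. x \<otimes> a) ` K" "y \<in> (\<lambda>x. x \<otimes> a) ` K"
  then obtain p q where "p \<in> K" "q \<in> K" "x = p \<otimes> a" "y = q \<otimes> a" by blast
  then show "x \<oplus> y \<in> (\<lambda>x. x \<otimes> a) ` K"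
    using K(1,3) assms(2) by (intro image_eqI[of _ _ "p \<oplus> q"]) (auto simp: l_distr subset_iff)
next
  note K = left_idealD[OF assms(1)]
  fix r x assume "r \<in> carrier R" "x \<in> (\<lambda>x. x \<otimes> a) ` K"
  then obtain p where "p \<in> K" "x = p \<otimes> a" by blast
  then show "r \<otimes> x \<in> (\<lambda>x. x \<otimes> a) ` K"
    using K(1,5) assms(2) \<open>r \<in> carrier R\<close>
    by (intro image_eqI[of _ _ "r \<otimes> p"]) (auto simp: m_assoc subset_iff)
qed

lemma left_ideal_carrier: "left_ideal (carrier R) R"
  by (rule left_idealI) auto

lemma left_ideal_principal: "a \<in> carrier R \<Longrightarrow> left_ideal ((\<lambda>x. x \<otimes> a) ` carrier R) R"
  by (rule left_ideal_mult_right[OF left_ideal_carrier])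

lemma left_ideal_vimage:
  assumes "left_ideal K R" "a \<in> carrier R"
  shows "left_ideal {x \<in> carrier R. x \<otimes> a \<in> K} R"
  by (rule left_idealI) (use assms left_idealD[OF assms(1)] in \<open>auto simp: l_distr m_assoc\<close>)

lemma left_ideal_left_ann: "X \<subseteq> carrier R \<Longrightarrow> left_ideal (left_ann R X) R"
  by (rule left_idealI) (auto simp: left_ann_def l_distr m_assoc subset_iff)

lemma left_ann_mult_mono:
  assumes "a \<in> carrier R" "b \<in> carrier R"
  shows "left_ann R {a} \<subseteq> left_ann R {a \<otimes> b}"
  using assms by (auto simp: left_ann_def simp flip: m_assoc)

lemma left_ideal_finsum:
  assumes "left_ideal D R" "finite F" "\<And>i. i \<in> F \<Longrightarrow> x i \<in> D"
  shows "finsum R x F \<in> D"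
  using assms(2,3)
proof induction
  case empty
  then show ?case using left_idealD(2)[OF assms(1)] by simp
next
  case (insert i F)
  have "x \<in> F \<rightarrow> carrier R" "x i \<in> carrier R"
    using insert.prems left_idealD(1)[OF assms(1)] by auto
  then show ?case using insert left_idealD(3)[OF assms(1)] by simp
qed

section \<open>Essential left ideals\<close>

lemma essentialE:
  assumes "essential E" "left_ideal K R" "K \<noteq> {\<zero>}"
  obtains x where "x \<in> E" "x \<in> K" "x \<in> carrier R" "x \<noteq> \<zero>"
proof -
  have "E \<inter> K \<noteq> {\<zero>}" "left_ideal (E \<inter> K) R"
    using assms left_ideal_Int by (auto simp: essential_def)
  then show ?thesis using that left_ideal_nonzeroE by blast
qed

lemma essentialI:
  assumes "left_ideal E R"
    and "\<And>K. left_ideal K R \<Longrightarrow> K \<noteq> {\<zero>} \<Longrightarrow> \<exists>x\<in>E \<inter> K. x \<noteq> \<zero>"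
  shows "essential E"
  using assms unfolding essential_def by blast

lemma essential_mono:
  assumes "essential E" "left_ideal F R" "E \<subseteq> F"
  shows "essential F"
  using assms(2)
proof (rule essentialI)
  fix K assume "left_ideal K R" "K \<noteq> {\<zero>}"
  then obtain x where "x \<in> E" "x \<in> K" "x \<noteq> \<zero>" by (rule essentialE[OF assms(1)])
  then show "\<exists>x\<in>F \<inter> K. x \<noteq> \<zero>" using assms(3) by blast
qed

text \<open>If \<open>K a\<close> is zero, then \<open>K\<close> itself lies in the preimage;
  otherwise \<open>K a\<close> is a nonzero left ideal, meets \<open>E\<close>, and any preimage in
  \<open>K\<close> of a common nonzero element will do. With \<open>E = R s\<close> this is the
  source of the left Ore condition.\<close>

lemma essential_vimage:
  assumes "essential E" "a \<in> carrier R"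
  shows "essential {x \<in> carrier R. x \<otimes> a \<in> E}"
proof (rule essentialI)
  have E: "left_ideal E R" using assms by (simp add: essential_def)
  show "left_ideal {x \<in> carrier R. x \<otimes> a \<in> E} R"
    by (rule left_ideal_vimage[OF E assms(2)])
  fix K assume K: "left_ideal K R" "K \<noteq> {\<zero>}"
  show "\<exists>x\<in>{x \<in> carrier R. x \<otimes> a \<in> E} \<inter> K. x \<noteq> \<zero>"
  proof (cases "(\<lambda>x. x \<otimes> a) ` K = {\<zero>}")
    case True
    obtain k where "k \<in> K" "k \<in> carrier R" "k \<noteq> \<zero>" using K by (rule left_ideal_nonzeroE)
    moreover from this have "k \<otimes> a = \<zero>" using True by blast
    ultimately show ?thesis using left_idealD(2)[OF E] by auto
  next
    case False
    then obtain y where "y \<in> E" "y \<in> (\<lambda>x. x \<otimes> a) ` K" "y \<noteq> \<zero>"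
      by (rule essentialE[OF assms(1) left_ideal_mult_right[OF K(1) assms(2)]])
    then obtain k where "k \<in> K" "k \<otimes> a \<in> E" "k \<otimes> a \<noteq> \<zero>" by blast
    moreover from this have "k \<noteq> \<zero>" using assms(2) by auto
    ultimately show ?thesis using left_idealD(1)[OF K(1)] by blast
  qed
qed

section \<open>Regular elements form a monoid\<close>

lemma regular_elems_closed: "c \<in> regular_elems R \<Longrightarrow> c \<in> carrier R"
  by (simp add: regular_elems_def)

lemma regular_elems_cancel:
  assumes "c \<in> regular_elems R" "r \<in> carrier R"
  shows "c \<otimes> r = \<zero> \<Longrightarrow> r = \<zero>" "r \<otimes> c = \<zero> \<Longrightarrow> r = \<zero>"
  using assms unfolding regular_elems_def by blast+

lemma regular_elemsI:
  assumes "c \<in> carrier R"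
    and "\<And>r. r \<in> carrier R \<Longrightarrow> c \<otimes> r = \<zero> \<Longrightarrow> r = \<zero>"
    and "\<And>r. r \<in> carrier R \<Longrightarrow> r \<otimes> c = \<zero> \<Longrightarrow> r = \<zero>"
  shows "c \<in> regular_elems R"
  using assms unfolding regular_elems_def by blast

lemma regular_elems_mult:
  assumes "c \<in> regular_elems R" "d \<in> regular_elems R"
  shows "c \<otimes> d \<in> regular_elems R"
proof -
  note cl = assms[THEN regular_elems_closed]
  have "r = \<zero>" if "r \<in> carrier R" "c \<otimes> d \<otimes> r = \<zero>" for r
    using that cl regular_elems_cancel(1)[OF assms(2), of r]
      regular_elems_cancel(1)[OF assms(1), of "d \<otimes> r"] by (simp add: m_assoc)
  moreover have "r = \<zero>" if "r \<in> carrier R" "r \<otimes> (c \<otimes> d) = \<zero>" for r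
    using that cl regular_elems_cancel(2)[OF assms(1), of r]
      regular_elems_cancel(2)[OF assms(2), of "r \<otimes> c"] by (simp add: m_assoc)
  ultimately show ?thesis using cl by (intro regular_elemsI m_closed)
qed

lemma one_regular: "\<one> \<in> regular_elems R"
  by (simp add: regular_elems_def)

text \<open>The set \<open>D n\<close> is a tail that contains every \<open>I k\<close> with
  \<open>k \<ge> n\<close>. In a vanishing sum, the nonzero term of least index \<open>n\<close> is
  the negative of the remaining sum, which lies in \<open>D (Suc n)\<close>, so this term is
  zero.\<close>

lemma direct_left_ideals_tails:
  assumes I: "\<And>n. left_ideal (I n) R" and D: "\<And>n. left_ideal (D n) R"
    and sub: "\<And>n. I n \<subseteq> D n" and desc: "\<And>n. D (Suc n) \<subseteq> D n"
    and disj: "\<And>n. I n \<inter> D (Suc n) = {\<zero>}"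
  shows "direct_left_ideals R (range I)"
  unfolding direct_left_ideals_def
proof (intro allI impI)
  fix F x assume "finite F \<and> F \<subseteq> range I \<and> (\<forall>J\<in>F. x J \<in> J) \<and> finsum R x F = \<zero>"
  then have F: "finite F" "F \<subseteq> range I" "\<And>J. J \<in> F \<Longrightarrow> x J \<in> J" "finsum R x F = \<zero>" by auto
  have anti: "D m \<subseteq> D n" if "n \<le> m" for m n
    using lift_Suc_antimono_le[of D] desc that by blast
  have cl: "x \<in> F \<rightarrow> carrier R"
    using F(2,3) left_idealD(1)[OF I] by blast
  show "\<forall>J\<in>F. x J = \<zero>"
  proof (rule ccontr)
    assume "\<not> ?thesis"
    then obtain m where "I m \<in> F \<and> x (I m) \<noteq> \<zero>" using F(2) by blast
    then obtain n where n: "I n \<in> F" "x (I n) \<noteq> \<zero>"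
      and least: "\<And>k. k < n \<Longrightarrow> \<not> (I k \<in> F \<and> x (I k) \<noteq> \<zero>)"
      using exists_least_iff[of "\<lambda>m. I m \<in> F \<and> x (I m) \<noteq> \<zero>"] by blast
    let ?F = "F - {I n}"
    \<comment> \<open>Any other summand is \<open>I k\<close> with \<open>k < n\<close>, where the
      term vanishes by the choice of \<open>n\<close>, or with \<open>k > n\<close>, where it lies
      in the tail.\<close>
    have "x J \<in> D (Suc n)" if J: "J \<in> ?F" for J
    proof -
      obtain k where k: "J = I k" using J F(2) by blast
      show ?thesis
      proof (cases "k < n")
        case True
        then show ?thesis using least[of k] J k left_idealD(2)[OF D] by auto
      next
        case False
        then have "Suc n \<le> k" using J k by (cases "k = n") auto
        then show ?thesis using anti sub[of k] F(3)[of J] J k by blast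
      qed
    qed
    then have rest: "finsum R x ?F \<in> D (Suc n)"
      using F(1) by (intro left_ideal_finsum[OF D]) auto
    have "finsum R x (insert (I n) ?F) = x (I n) \<oplus> finsum R x ?F"
      using F(1) n(1) cl by (intro finsum_insert) auto
    then have "x (I n) \<oplus> finsum R x ?F = \<zero>"
      using F(4) n(1) by (simp add: insert_absorb)
    then have "x (I n) = \<ominus> finsum R x ?F"
      using n(1) cl by (intro minus_equality[symmetric]) (auto simp: a_comm intro!: finsum_closed)
    then have "x (I n) \<in> D (Suc n)"
      using left_idealD(4)[OF D rest] by simp
    then show False using disj[of n] F(3)[OF n(1)] n(2) by blast
  qed
qed

end

section \<open>Goldie's theorem\<close>

locale semiprime_left_goldie = ring R for R (structure) +
  assumes semiprime: "semiprime_ring R" and goldie: "left_goldie R"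
begin

text \<open>The ideal generated by \<open>b\<close> has square zero when \<open>b R b = 0\<close>.
  Instead of describing its elements as sums, the proof places it inside two annihilator ideals that
  contain \<open>b\<close>.\<close>

lemma semiprime_elem:
  assumes b: "b \<in> carrier R" and z: "\<And>r. r \<in> carrier R \<Longrightarrow> b \<otimes> r \<otimes> b = \<zero>"
  shows "b = \<zero>"
proof -
  let ?I = "Idl {b}"
  have I: "ideal ?I R" using b by (intro genideal_ideal) auto
  have bI: "b \<in> ?I" using genideal_self[of "{b}"] b by auto
  have *: "x \<otimes> b = \<zero>" if "x \<in> ?I" for x
  proof -
    let ?A = "{x \<in> carrier R. \<forall>r\<in>carrier R. x \<otimes> r \<otimes> b = \<zero>}"
    have "left_ideal ?A R"
      using b by (intro left_idealI) (auto simp: l_distr m_assoc)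
    moreover have "y \<otimes> s \<in> ?A" if "y \<in> ?A" "s \<in> carrier R" for y s
      using that by (auto simp: m_assoc[of y s])
    ultimately have "ideal ?A R"
      by (intro idealI) (auto simp: left_ideal_def ring_axioms additive_subgroup.a_subgroup)
    then have "?I \<subseteq> ?A" using b z by (intro genideal_minimal) auto
    then have "x \<in> ?A" using that by blast
    then have x: "x \<in> carrier R" "\<forall>r\<in>carrier R. x \<otimes> r \<otimes> b = \<zero>" by blast+
    show ?thesis using bspec[OF x(2) one_closed] x(1) by simp
  qed
  \<comment> \<open>The right annihilator of \<open>?I\<close>. It contains \<open>b\<close> by
    \<open>*\<close>, hence all of \<open>?I\<close>.\<close>
  let ?B = "{y \<in> carrier R. \<forall>x\<in>?I. x \<otimes> y = \<zero>}"
  have Ic: "x \<in> ?I \<Longrightarrow> x \<in> carrier R" for x using ideal.Icarr[OF I] .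
  have mi: "x \<otimes> (r \<otimes> y) = \<zero>"
    if "x \<in> ?I" "r \<in> carrier R" "y \<in> ?B" for x r y
    using that ideal.I_r_closed[OF I that(1,2)] Ic[OF that(1)] by (simp flip: m_assoc)
  have "left_ideal ?B R"
    by (intro left_idealI) (use Ic mi in \<open>auto simp: r_distr\<close>)
  then have "ideal ?B R"
    using Ic by (intro idealI)
      (auto simp: left_ideal_def ring_axioms additive_subgroup.a_subgroup simp flip: m_assoc)
  then have "?I \<subseteq> ?B" using b * by (intro genideal_minimal) auto
  then have "?I \<cdot> ?I \<subseteq> {\<zero>}"
  proof (intro subsetI)
    fix s assume "s \<in> ?I \<cdot> ?I"
    then show "s \<in> {\<zero>}"
      by induction (use \<open>?I \<subseteq> ?B\<close> in auto)
  qed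
  moreover have "\<zero> \<in> ?I \<cdot> ?I"
    using additive_subgroup.zero_closed[OF ideal.axioms(1)[OF ideal_prod_is_ideal[OF I I]]] .
  \<comment> \<open>One iteration already stands for the square of the ideal.\<close>
  ultimately have "((\<lambda>J. J \<cdot> ?I) ^^ 1) ?I = {\<zero>}" by auto
  then have "?I = {\<zero>}" using semiprime I unfolding semiprime_ring_def by blast
  then show ?thesis using bI by blast
qed

section \<open>Annihilator chains and nil one-sided ideals\<close>

lemma left_ann_acc:
  assumes "\<And>n. X n \<subseteq> carrier R" "\<And>n. left_ann R (X n) \<subseteq> left_ann R (X (Suc n))"
  shows "\<exists>n. \<forall>m\<ge>n. left_ann R (X m) = left_ann R (X n)"
proof -
  have "\<And>n. \<exists>Y\<subseteq>carrier R. left_ann R (X n) = left_ann R Y" using assms(1) by blast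
  then show ?thesis
    using goldie assms(2) unfolding left_goldie_def
    by (elim conjE allE[of _ "\<lambda>n. left_ann R (X n)"] impE) auto
qed

text \<open>The relation \<open>?r\<close> puts larger annihilators lower. The ascending chain
  condition thus makes it well-founded, and its minimal elements are the ones sought.\<close>

lemma ex_max_left_ann:
  assumes "N \<subseteq> carrier R" "N \<noteq> {}"
  obtains b where "b \<in> N"
    "\<forall>d\<in>N. left_ann R {b} \<subseteq> left_ann R {d} \<longrightarrow> left_ann R {d} = left_ann R {b}"
proof -
  let ?r = "{(d, b). d \<in> N \<and> b \<in> N \<and> left_ann R {b} \<subset> left_ann R {d}}"
  have wf: "wf ?r"
    unfolding wf_iff_no_infinite_down_chain
  proof
    assume "\<exists>f. \<forall>i. (f (Suc i), f i) \<in> ?r"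
    then obtain f where f: "\<forall>i. (f (Suc i), f i) \<in> ?r" ..
    have "\<exists>n. \<forall>m\<ge>n. left_ann R {f m} = left_ann R {f n}"
      using f assms(1) by (intro left_ann_acc[of "\<lambda>i. {f i}"]) auto
    then obtain n where n: "\<forall>m\<ge>n. left_ann R {f m} = left_ann R {f n}" ..
    have "left_ann R {f (Suc n)} = left_ann R {f n}" by (rule n[rule_format]) simp
    then show False using spec[OF f, of n] by simp
  qed
  obtain b0 where "b0 \<in> N" using assms(2) by blast
  then obtain b where "b \<in> N" "\<forall>d. (d, b) \<in> ?r \<longrightarrow> d \<notin> N"
    using wf unfolding wf_eq_minimal by meson
  then show ?thesis by (intro that[of b]) blast+
qed

text \<open>If \<open>b \<noteq> 0\<close> is taken in \<open>x R\<close> with maximal left annihilator, nilpotency of \<open>b r\<close> forces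
  \<open>b r b = 0\<close>, because the left annihilator of the last nonzero power of \<open>b r\<close> is that of \<open>b\<close>.\<close>

lemma nil_right_ideal_zero:
  assumes x: "x \<in> carrier R" and nil: "\<And>r. r \<in> carrier R \<Longrightarrow> \<exists>n. (x \<otimes> r) [^] (n::nat) = \<zero>"
  shows "x = \<zero>"
proof (rule ccontr)
  assume "x \<noteq> \<zero>"
  let ?N = "{x \<otimes> r | r. r \<in> carrier R \<and> x \<otimes> r \<noteq> \<zero>}"
  have "x \<otimes> \<one> \<in> ?N" using x \<open>x \<noteq> \<zero>\<close> one_closed by fastforce
  then have N: "?N \<subseteq> carrier R" "?N \<noteq> {}" using x by auto
  obtain b where b: "b \<in> ?N"
    and max: "\<forall>d\<in>?N. left_ann R {b} \<subseteq> left_ann R {d} \<longrightarrow> left_ann R {d} = left_ann R {b}"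
    by (rule ex_max_left_ann[OF N])
  obtain p where p: "p \<in> carrier R" "b = x \<otimes> p" "b \<noteq> \<zero>" using b by blast
  have bc: "b \<in> carrier R" using x p by simp
  have "b \<otimes> r \<otimes> b = \<zero>" if r: "r \<in> carrier R" for r
  proof (cases "b \<otimes> r = \<zero>")
    case True
    then show ?thesis using bc by simp
  next
    case False
    let ?c = "b \<otimes> r"
    have cc: "?c \<in> carrier R" using bc r by simp
    have "\<exists>n. ?c [^] (n::nat) = \<zero>"
      using nil[of "p \<otimes> r"] p x r by (simp add: m_assoc)
    then obtain k where k: "?c [^] (k::nat) = \<zero>" "\<And>j. j < k \<Longrightarrow> ?c [^] j \<noteq> \<zero>"
      using exists_least_iff[of "\<lambda>n. ?c [^] (n::nat) = \<zero>"] by blast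
    have "k \<noteq> 0" using k(1) False cc by (metis nat_pow_0 r_null r_one)
    moreover have "k \<noteq> 1" using k(1) False cc by auto
    \<comment> \<open>The last nonzero power has exponent \<open>Suc j\<close>. This exponent is
      positive, so the power starts with the factor \<open>b\<close> and belongs to
      \<open>?N\<close>.\<close>
    ultimately obtain j where j: "k = Suc (Suc j)" by (metis One_nat_def not0_implies_Suc)
    have e: "?c [^] Suc j = b \<otimes> (r \<otimes> ?c [^] j)"
      using nat_pow_Suc2[OF cc, of j] bc r cc by (simp add: m_assoc)
    have "?c [^] Suc j = x \<otimes> (p \<otimes> (r \<otimes> ?c [^] j))"
      unfolding e using p x r cc by (simp add: m_assoc)
    then have "?c [^] Suc j \<in> ?N"
      using k(2)[of "Suc j"] j p r cc by (auto intro!: exI[of _ "p \<otimes> (r \<otimes> ?c [^] j)"])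
    moreover have "left_ann R {b} \<subseteq> left_ann R {?c [^] Suc j}"
      unfolding e using bc r cc by (intro left_ann_mult_mono) auto
    ultimately have "left_ann R {?c [^] Suc j} = left_ann R {b}" using max by blast
    moreover have "?c \<in> left_ann R {?c [^] Suc j}"
      using k(1) nat_pow_Suc2[OF cc, of "Suc j"] cc unfolding j by (simp add: left_ann_def)
    ultimately show ?thesis by (simp add: left_ann_def)
  qed
  then have "b = \<zero>" using semiprime_elem bc by blast
  then show False using p by blast
qed

text \<open>The left annihilators of the powers of \<open>b\<close> ascend, hence are constant from
  some \<open>N\<close> on. Then \<open>b [^] Suc N\<close> and its square have the same left
  annihilator; the successor makes the exponent positive.\<close>

lemma ex_ann_stable_power:
  assumes b: "b \<in> carrier R"
  obtains n where "n > 0" "ann_stable (b [^] (n::nat))"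
proof -
  have "\<exists>N::nat. \<forall>m\<ge>N. left_ann R {b [^] m} = left_ann R {b [^] N}"
    by (rule left_ann_acc[of "\<lambda>n::nat. {b [^] n}"])
      (use b left_ann_mult_mono[OF nat_pow_closed[OF b] b] in auto)
  then obtain N :: nat where "\<forall>m\<ge>N. left_ann R {b [^] m} = left_ann R {b [^] N}" ..
  note N = this[rule_format]
  have "left_ann R {b [^] (Suc N + Suc N)} = left_ann R {b [^] Suc N}"
    using N[of "Suc N + Suc N"] N[of "Suc N"] by simp
  then have "x \<otimes> b [^] Suc N = \<zero>"
    if "x \<in> carrier R" "x \<otimes> b [^] Suc N \<otimes> b [^] Suc N = \<zero>" for x
    using that b nat_pow_mult[OF b, of "Suc N" "Suc N"] by (auto simp: left_ann_def m_assoc)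
  then have "ann_stable (b [^] Suc N)" by (simp add: ann_stable_def)
  then show ?thesis by (rule that[rotated]) simp
qed

text \<open>Some \<open>b\<close> in \<open>D\<close> is not nilpotent: otherwise every
  \<open>r d\<close> with \<open>d\<close> in \<open>D\<close> would be nilpotent, hence every
  \<open>d r\<close>, which forces \<open>d = 0\<close>. A suitable power of \<open>b\<close> is
  then nonzero and stable.\<close>

lemma left_ideal_ex_ann_stable:
  assumes D: "left_ideal D R" "D \<noteq> {\<zero>}"
  obtains a where "a \<in> D" "a \<noteq> \<zero>" "ann_stable a"
proof -
  note DD = left_idealD[OF D(1)]
  obtain d where d: "d \<in> D" "d \<in> carrier R" "d \<noteq> \<zero>" using D by (rule left_ideal_nonzeroE)
  have "\<exists>b\<in>D. \<forall>n::nat. b [^] n \<noteq> \<zero>"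
  proof (rule ccontr)
    assume *: "\<not> ?thesis"
    have "\<exists>n. (d \<otimes> r) [^] (n::nat) = \<zero>" if r: "r \<in> carrier R" for r
    proof -
      obtain n where n: "(r \<otimes> d) [^] (n::nat) = \<zero>" using * DD(5)[OF r d(1)] by blast
      have "(d \<otimes> r) [^] Suc m = d \<otimes> (r \<otimes> d) [^] m \<otimes> r" for m
      proof (induction m)
        case 0
        then show ?case using r d by simp
      next
        case (Suc m)
        have "(d \<otimes> r) [^] Suc (Suc m) = d \<otimes> (r \<otimes> d) [^] m \<otimes> r \<otimes> (d \<otimes> r)"
          using Suc.IH by simp
        then show ?case using r d by (simp add: m_assoc)
      qed
      from this[of n] show ?thesis using n r d by (auto intro: exI[of _ "Suc n"])
    qed
    then show False using nil_right_ideal_zero d by blast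
  qed
  then obtain b where b: "b \<in> D" "\<And>n. b [^] (n::nat) \<noteq> \<zero>" by blast
  then have bc: "b \<in> carrier R" using DD(1) by blast
  obtain n where n: "n > 0" "ann_stable (b [^] (n::nat))"
    using bc by (rule ex_ann_stable_power)
  have "b [^] n = b [^] (n - 1) \<otimes> b" using n(1) by (metis Suc_diff_1 nat_pow_Suc)
  then have "b [^] n \<in> D" using DD(5)[OF nat_pow_closed[OF bc] b(1)] by metis
  then show ?thesis using that n(2) b(2) by blast
qed

text \<open>In other words, the left singular ideal is zero. A stable power of \<open>x r\<close>
  has an essential left annihilator, since it contains that of \<open>x\<close>. By stability this
  annihilator meets the principal left ideal of the power trivially, so the power is zero and
  \<open>x R\<close> is nil.\<close>

lemma essential_left_ann_zero:
  assumes x: "x \<in> carrier R" and E: "essential (left_ann R {x})"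
  shows "x = \<zero>"
proof (rule nil_right_ideal_zero[OF x])
  fix r assume r: "r \<in> carrier R"
  let ?y = "x \<otimes> r"
  have yc: "?y \<in> carrier R" using x r by simp
  obtain n where n: "n > 0" "ann_stable (?y [^] (n::nat))"
    using yc by (rule ex_ann_stable_power)
  have "?y [^] n = ?y \<otimes> ?y [^] (n - 1)" using n(1) nat_pow_Suc2[OF yc, of "n - 1"] by simp
  also have "\<dots> = x \<otimes> (r \<otimes> ?y [^] (n - 1))" using x r yc by (simp add: m_assoc)
  finally have "left_ann R {x} \<subseteq> left_ann R {?y [^] n}"
    using left_ann_mult_mono[of x "r \<otimes> ?y [^] (n - 1)"] x r yc by simp
  then have ess: "essential (left_ann R {?y [^] n})"
    using essential_mono[OF E] left_ideal_left_ann yc by simp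
  have "(\<lambda>z. z \<otimes> ?y [^] n) ` carrier R = {\<zero>}"
  proof (rule ccontr)
    assume "\<not> ?thesis"
    then obtain w where "w \<in> left_ann R {?y [^] n}" "w \<in> (\<lambda>z. z \<otimes> ?y [^] n) ` carrier R" "w \<noteq> \<zero>"
      by (rule essentialE[OF ess left_ideal_principal[OF nat_pow_closed[OF yc]]])
    then show False using n(2) by (auto simp: left_ann_def ann_stable_def)
  qed
  then have "\<one> \<otimes> ?y [^] n = \<zero>" using one_closed by blast
  then show "\<exists>n. ?y [^] (n::nat) = \<zero>" using yc by auto
qed

text \<open>This is the form in which the absence of infinite direct sums is applied: a descending
  chain of left ideals cannot lose a nonzero independent piece at every step.\<close>

lemma no_infinite_direct_sum:
  assumes I: "\<And>n. left_ideal (I n) R" "\<And>n. I n \<noteq> {\<zero>}" and D: "\<And>n::nat. left_ideal (D n) R"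
    and sub: "\<And>n. I n \<subseteq> D n" and desc: "\<And>n. D (Suc n) \<subseteq> D n"
    and disj: "\<And>n. I n \<inter> D (Suc n) = {\<zero>}"
  shows False
proof -
  have anti: "D m \<subseteq> D n" if "n \<le> m" for m n
    using lift_Suc_antimono_le[of D] desc that by blast
  \<comment> \<open>Goldie's condition speaks of an infinite set of left ideals, so the pieces must
    be distinct. A later piece lies in \<open>D (Suc n)\<close>, which meets \<open>I n\<close> only
    in zero.\<close>
  have "I m \<noteq> I n" if "n < m" for m n
    using sub[of m] anti[of "Suc n" m] disj[of n] I(2)[of n] that by auto
  then have "inj I" by (metis injI linorder_neqE_nat)
  then have "infinite (range I)" using finite_imageD by blast
  moreover have "direct_left_ideals R (range I)"
    by (intro direct_left_ideals_tails[of I D] assms)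
  moreover have "\<forall>J\<in>range I. left_ideal J R \<and> J \<noteq> {\<zero>}" using I by simp
  ultimately show False
    using goldie unfolding left_goldie_def by (elim conjE notE[of "\<exists>I. _ I"]) (intro exI conjI)
qed

text \<open>If \<open>R c\<close> meets \<open>K\<close> trivially, then the sum \<open>K + K c + K c\<^sup>2 + \<dots>\<close> is direct.\<close>

lemma essential_principal:
  assumes c: "c \<in> carrier R" and inj: "\<And>x. x \<in> carrier R \<Longrightarrow> x \<otimes> c = \<zero> \<Longrightarrow> x = \<zero>"
  shows "essential ((\<lambda>x. x \<otimes> c) ` carrier R)"
proof (rule essentialI[OF left_ideal_principal[OF c]], rule ccontr)
  fix K assume K: "left_ideal K R" "K \<noteq> {\<zero>}"
    and no: "\<not> (\<exists>x\<in>(\<lambda>x. x \<otimes> c) ` carrier R \<inter> K. x \<noteq> \<zero>)"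
  note KD = left_idealD[OF K(1)]
  have injn: "x = \<zero>" if "x \<in> carrier R" "x \<otimes> c [^] n = \<zero>" for x and n :: nat
    using that
  proof (induction n)
    case (Suc n)
    then show ?case using inj[of "x \<otimes> c [^] n"] c by (simp add: m_assoc)
  qed auto
  \<comment> \<open>The tail of the sum is enlarged to the principal left ideal of
    \<open>c [^] n\<close>. Cancelling this power reduces independence to the trivial intersection
    of \<open>K\<close> with \<open>R c\<close>.\<close>
  let ?I = "\<lambda>n::nat. (\<lambda>x. x \<otimes> c [^] n) ` K" and ?D = "\<lambda>n::nat. (\<lambda>x. x \<otimes> c [^] n) ` carrier R"
  show False
  proof (rule no_infinite_direct_sum[of ?I ?D])
    fix n
    show "left_ideal (?I n) R" using left_ideal_mult_right[OF K(1)] c by simp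
    show "left_ideal (?D n) R" using left_ideal_principal c by simp
    show "?I n \<subseteq> ?D n" using KD(1) by blast
    obtain k where k: "k \<in> K" "k \<in> carrier R" "k \<noteq> \<zero>" using K by (rule left_ideal_nonzeroE)
    then have "k \<otimes> c [^] n \<noteq> \<zero>" using injn by blast
    then show "?I n \<noteq> {\<zero>}" using k(1) by blast
    have "x \<otimes> c [^] Suc n = (x \<otimes> c) \<otimes> c [^] n" if "x \<in> carrier R" for x
      using that c nat_pow_Suc2[OF c, of n] by (simp add: m_assoc)
    note step = this
    then show "?D (Suc n) \<subseteq> ?D n" using c by auto
    show "?I n \<inter> ?D (Suc n) = {\<zero>}"
    proof (intro equalityI subsetI)
      fix y assume "y \<in> ?I n \<inter> ?D (Suc n)"
      then obtain k x where kx: "k \<in> K" "x \<in> carrier R" "y = k \<otimes> c [^] n" "y = (x \<otimes> c) \<otimes> c [^] n"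
        using step by auto
      have kc: "k \<in> carrier R" using kx(1) KD(1) by blast
      have "(k \<ominus> x \<otimes> c) \<otimes> c [^] n = \<zero>"
        using kx kc c by (simp add: minus_eq l_distr l_minus r_neg)
      then have "k \<ominus> x \<otimes> c = \<zero>" using injn[of "k \<ominus> x \<otimes> c"] kc kx c by simp
      then have "k = x \<otimes> c" using kc kx(2) c minus_equality[of k "\<ominus> (x \<otimes> c)"] by (simp add: minus_eq)
      then have "k = \<zero>" using no kx(1,2) by blast
      then show "y \<in> {\<zero>}" using kx c by simp
    next
      fix y assume "y \<in> {\<zero>}"
      then show "y \<in> ?I n \<inter> ?D (Suc n)"
        using left_idealD(2)[OF left_ideal_mult_right[OF K(1)], of "c [^] n"]
          left_idealD(2)[OF left_ideal_principal, of "c [^] Suc n"] c by simp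
    qed
  qed
qed

text \<open>If \<open>c x = 0\<close>, then the left annihilator of \<open>x\<close> contains
  \<open>R c\<close>, which is essential, so \<open>x\<close> is zero because the left singular
  ideal vanishes.\<close>

lemma regular_if_left_ann_zero:
  assumes c: "c \<in> carrier R" and inj: "\<And>x. x \<in> carrier R \<Longrightarrow> x \<otimes> c = \<zero> \<Longrightarrow> x = \<zero>"
  shows "c \<in> regular_elems R"
proof -
  have "x = \<zero>" if x: "x \<in> carrier R" "c \<otimes> x = \<zero>" for x
  proof (rule essential_left_ann_zero[OF x(1)])
    have "(\<lambda>y. y \<otimes> c) ` carrier R \<subseteq> left_ann R {x}"
      using x c by (auto simp: left_ann_def m_assoc)
    then show "essential (left_ann R {x})"
      using essential_mono[OF essential_principal[OF c inj] left_ideal_left_ann] x by blast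
  qed
  then show ?thesis using assms by (intro regular_elemsI) blast+
qed

text \<open>Among the \<open>c \<in> E\<close> with \<open>left_ann c = left_ann c\<^sup>2\<close>, choose one with \<open>E \<inter> left_ann c\<close> minimal with
  respect to dropping a direct summand. If \<open>E \<inter> left_ann c\<close> contained some \<open>a \<noteq> 0\<close> of the same kind,
  then \<open>a c = 0\<close>, and \<open>c + a\<close> would be a better choice since
  \<open>left_ann (c + a) = left_ann c \<inter> left_ann a\<close>.\<close>

theorem essential_contains_regular:
  assumes E: "essential E"
  obtains c where "c \<in> E" "c \<in> regular_elems R"
proof -
  have EL: "left_ideal E R" using E by (simp add: essential_def)
  note ED = left_idealD[OF EL]
  let ?D = "\<lambda>c. E \<inter> left_ann R {c}"
  let ?r = "{(d, c). c \<in> E \<and> d \<in> E \<and> ?D d \<subseteq> ?D c \<and>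
    (\<exists>I. left_ideal I R \<and> I \<noteq> {\<zero>} \<and> I \<subseteq> ?D c \<and> I \<inter> ?D d = {\<zero>})}"
  have DL: "left_ideal (?D c) R" if "c \<in> E" for c
    using that EL ED(1) by (intro left_ideal_Int left_ideal_left_ann) auto
  have wf: "wf ?r"
    unfolding wf_iff_no_infinite_down_chain
  proof
    assume "\<exists>f. \<forall>i. (f (Suc i), f i) \<in> ?r"
    then obtain f where f: "\<forall>i. (f (Suc i), f i) \<in> ?r" ..
    then have f: "f i \<in> E" "?D (f (Suc i)) \<subseteq> ?D (f i)"
      "\<exists>I. left_ideal I R \<and> I \<noteq> {\<zero>} \<and> I \<subseteq> ?D (f i) \<and> I \<inter> ?D (f (Suc i)) = {\<zero>}" for i
      by blast+
    obtain I where I: "\<And>i. left_ideal (I i) R \<and> I i \<noteq> {\<zero>} \<and> I i \<subseteq> ?D (f i) \<and>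
        I i \<inter> ?D (f (Suc i)) = {\<zero>}"
      using f(3) by metis
    show False
      by (rule no_infinite_direct_sum[of I "\<lambda>i. ?D (f i)"]) (use I f(2) DL[OF f(1)] in simp_all)
  qed
  have "\<zero> \<in> {c \<in> E. ann_stable c}" using ED(2) by (auto simp: ann_stable_def)
  then obtain c where "c \<in> {c \<in> E. ann_stable c}"
    and min: "\<forall>d. (d, c) \<in> ?r \<longrightarrow> d \<notin> {c \<in> E. ann_stable c}"
    using wf unfolding wf_eq_minimal by meson
  then have c: "c \<in> E" "ann_stable c" by auto
  have cc: "c \<in> carrier R" using c ED(1) by blast
  have sq: "x \<otimes> c = \<zero>" if "x \<in> carrier R" "x \<otimes> c \<otimes> c = \<zero>" for x
    using c(2) that by (simp add: ann_stable_def)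
  have "?D c = {\<zero>}"
  proof (rule ccontr)
    assume "?D c \<noteq> {\<zero>}"
    then obtain a where a: "a \<in> ?D c" "a \<noteq> \<zero>" "ann_stable a"
      by (rule left_ideal_ex_ann_stable[OF DL[OF c(1)]])
    then have asq: "x \<otimes> a = \<zero>" if "x \<in> carrier R" "x \<otimes> a \<otimes> a = \<zero>" for x
      using that by (simp add: ann_stable_def)
    have ac: "a \<in> carrier R" "a \<otimes> c = \<zero>" "a \<in> E" using a by (auto simp: left_ann_def)
    have xac: "x \<otimes> a \<otimes> c = \<zero>" if "x \<in> carrier R" for x
      using that ac cc by (simp add: m_assoc)
    \<comment> \<open>Right multiplication by \<open>c\<close> kills \<open>x a\<close> because
      \<open>a c = 0\<close>. This leaves \<open>x c c = 0\<close>, and stability of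
      \<open>c\<close> separates the two terms.\<close>
    have split: "x \<otimes> c = \<zero> \<and> x \<otimes> a = \<zero>" if x: "x \<in> carrier R" "x \<otimes> (c \<oplus> a) = \<zero>" for x
    proof -
      have s: "x \<otimes> c \<oplus> x \<otimes> a = \<zero>" using x ac cc by (simp add: r_distr)
      then have "(x \<otimes> c \<oplus> x \<otimes> a) \<otimes> c = \<zero>" using cc by simp
      then have "x \<otimes> c \<otimes> c = \<zero>" using x(1) cc ac(1) xac by (simp add: l_distr)
      then have "x \<otimes> c = \<zero>" using sq x(1) by blast
      then show ?thesis using s x(1) ac(1) by simp
    qed
    have "ann_stable (c \<oplus> a)"
      unfolding ann_stable_def
    proof (intro ballI impI)
      fix x assume x: "x \<in> carrier R" "x \<otimes> (c \<oplus> a) \<otimes> (c \<oplus> a) = \<zero>"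
      have "x \<otimes> (c \<oplus> a) \<otimes> c = \<zero>" "x \<otimes> (c \<oplus> a) \<otimes> a = \<zero>"
        using split[of "x \<otimes> (c \<oplus> a)"] x ac cc by auto
      then have e: "x \<otimes> c \<otimes> c \<oplus> x \<otimes> a \<otimes> c = \<zero>" "x \<otimes> c \<otimes> a \<oplus> x \<otimes> a \<otimes> a = \<zero>"
        using x(1) ac(1) cc by (simp_all add: r_distr l_distr)
      have 1: "x \<otimes> c = \<zero>" using e(1) xac[OF x(1)] x(1) cc sq by simp
      then have "x \<otimes> a \<otimes> a = \<zero>" using e(2) x(1) ac(1) by simp
      then show "x \<otimes> (c \<oplus> a) = \<zero>" using 1 asq x(1) ac(1) cc by (simp add: r_distr)
    qed
    moreover have "c \<oplus> a \<in> E" using ED(3) c(1) ac(3) by blast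
    moreover have "(c \<oplus> a, c) \<in> ?r"
    proof -
      \<comment> \<open>The dropped summand is \<open>R a\<close>: it is annihilated by
        \<open>c\<close>, and stability of \<open>a\<close> keeps it apart from the left annihilator
        of \<open>c \<oplus> a\<close>.\<close>
      let ?I = "(\<lambda>x. x \<otimes> a) ` carrier R"
      have 1: "?D (c \<oplus> a) \<subseteq> ?D c" using split by (auto simp: left_ann_def)
      have 2: "?I \<subseteq> ?D c"
        using ac ED(5) xac by (auto simp: left_ann_def)
      have 3: "?I \<noteq> {\<zero>}" using a(2) ac(1) one_closed l_one by (metis image_eqI singletonD)
      have "y = \<zero>" if "y \<in> ?I" "y \<in> ?D (c \<oplus> a)" for y
        using that split asq by (auto simp: left_ann_def)
      then have 4: "?I \<inter> ?D (c \<oplus> a) = {\<zero>}"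
        using left_idealD(2)[OF left_ideal_principal[OF ac(1)]] left_idealD(2)[OF DL[of "c \<oplus> a"]]
          \<open>c \<oplus> a \<in> E\<close> by blast
      show ?thesis using c(1) \<open>c \<oplus> a \<in> E\<close> 1 2 3 4 left_ideal_principal[OF ac(1)] by blast
    qed
    ultimately show False using min by blast
  qed
  \<comment> \<open>Here essentiality of \<open>E\<close> enters: a left ideal that meets
    \<open>E\<close> trivially is zero.\<close>
  then have "left_ann R {c} = {\<zero>}"
    using E left_ideal_left_ann[of "{c}"] cc by (auto simp: essential_def)
  then have "c \<in> regular_elems R"
    using cc by (intro regular_if_left_ann_zero) (auto simp: left_ann_def)
  then show ?thesis using that c(1) by blast
qed

text \<open>The candidates for \<open>v\<close> form the preimage of the essential left ideal
  \<open>R s\<close> under right multiplication by \<open>r\<close>. This preimage is essential, so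
  it contains a regular element.\<close>

theorem regular_left_ore:
  assumes "r \<in> carrier R" "s \<in> regular_elems R"
  obtains v w where "v \<in> regular_elems R" "w \<in> carrier R" "v \<otimes> r = w \<otimes> s"
proof -
  let ?Rs = "(\<lambda>x. x \<otimes> s) ` carrier R"
  have "essential ?Rs"
    using regular_elems_closed[OF assms(2)] regular_elems_cancel(2)[OF assms(2)]
    by (rule essential_principal)
  then have "essential {x \<in> carrier R. x \<otimes> r \<in> ?Rs}"
    using assms(1) by (rule essential_vimage)
  then obtain v where "v \<in> {x \<in> carrier R. x \<otimes> r \<in> ?Rs}" "v \<in> regular_elems R"
    by (rule essential_contains_regular)
  then show ?thesis using that by blast
qed

corollary regular_Den_l:
  assumes "\<one> \<noteq> \<zero>"
  shows "regular_elems R \<in> Den_l R"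
  unfolding Den_l_iff
proof (intro conjI ballI impI)
  show "regular_elems R \<subseteq> carrier R" using regular_elems_closed by (rule subsetI)
  show "\<zero> \<notin> regular_elems R"
    using assms regular_elems_cancel(1)[of \<zero> \<one>] by auto
  show "\<exists>s'\<in>regular_elems R. \<exists>r'\<in>carrier R. s' \<otimes> r = r' \<otimes> s"
    if "r \<in> carrier R" "s \<in> regular_elems R" for r s
    by (rule regular_left_ore[OF that]) blast
  show "\<exists>t\<in>regular_elems R. t \<otimes> r = \<zero>"
    if "r \<in> carrier R" "s \<in> regular_elems R" "r \<otimes> s = \<zero>" for r s
    using regular_elems_cancel(2)[OF that(2,1,3)] one_regular by (intro bexI[of _ \<one>]) auto
qed (rule one_regular, rule regular_elems_mult, assumption+)

end

section \<open>Maximal left denominator sets\<close>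

text \<open>The monoid generated by \<open>M\<close> and the regular elements is a left denominator
  set as soon as it omits zero; maximality of \<open>M\<close> then makes it equal to
  \<open>M\<close>.\<close>

lemma (in ring) regular_subset_max_Den_l:
  assumes C: "regular_elems R \<in> Den_l R" and M: "M \<in> max_Den_l R"
  shows "regular_elems R \<subseteq> M"
proof -
  let ?G = "M \<union> regular_elems R"
  have MD: "M \<in> Den_l R" using M by (simp add: max_Den_l_def)
  have Mc: "t \<in> carrier R" if "t \<in> M" for t using MD that by (auto simp: Den_l_iff)
  have G: "?G \<subseteq> carrier R" using Mc regular_elems_closed by blast
  \<comment> \<open>The induction needs the stronger claim with left multipliers from
    \<open>M\<close>. A last factor \<open>g\<close> from \<open>M\<close> is traded for a new
    multiplier \<open>u\<close> on the left, and a regular \<open>g\<close> is cancelled.\<close>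
  have nz: "\<forall>t\<in>M. t \<otimes> m \<noteq> \<zero>" if "m \<in> mgen R ?G" for m
    using that
  proof induction
    case one
    then show ?case using MD Mc by (auto simp: Den_l_iff)
  next
    case (step m g)
    have mc: "m \<in> carrier R" "g \<in> carrier R" using step mgen_carrier[OF G] G by blast+
    show ?case
    proof (intro ballI notI)
      fix t assume t: "t \<in> M" "t \<otimes> (m \<otimes> g) = \<zero>"
      then have z: "t \<otimes> m \<otimes> g = \<zero>" "t \<otimes> m \<in> carrier R" using mc Mc by (simp_all add: m_assoc)
      show False
      proof (cases "g \<in> M")
        case True
        then obtain u where u: "u \<in> M" "u \<otimes> (t \<otimes> m) = \<zero>"
          using MD z unfolding Den_l_iff by blast
        moreover have "u \<otimes> t \<in> M" using MD u(1) t(1) by (simp add: Den_l_iff)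
        ultimately show False using step.IH mc Mc t(1) by (metis m_assoc)
      next
        case False
        then show False using regular_elems_cancel(2)[OF _ z(2,1)] step t(1) by blast
      qed
    qed
  qed
  have "\<zero> \<notin> mgen R ?G"
  proof
    assume "\<zero> \<in> mgen R ?G"
    moreover have "\<one> \<in> M" using MD by (simp add: Den_l_iff)
    ultimately show False using nz by fastforce
  qed
  then have "mgen R ?G \<in> Den_l R" using mgen_Den_l MD C by blast
  then have "mgen R ?G = M"
    using M mgen_incl[OF G] unfolding max_Den_l_def by blast
  then show ?thesis using mgen_incl[OF G] by blast
qed

text \<open>For sums, the Ore condition yields a common left multiple in \<open>S\<close> of the two
  annihilating elements. For left multiples, it moves the annihilating element past
  \<open>r\<close>.\<close>

lemma (in ring) ass_ideal:
  assumes S: "S \<in> Den_l R"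
  shows "ideal (ass R S) R"
proof -
  note D = S[unfolded Den_l_iff]
  have Sc: "s \<in> carrier R" if "s \<in> S" for s using D that by blast
  have "left_ideal (ass R S) R"
  proof (rule left_idealI)
    show "ass R S \<subseteq> carrier R" by (auto simp: ass_def)
    show "\<zero> \<in> ass R S" using D by (auto simp: ass_def intro!: bexI[of _ \<one>])
  next
    fix x y assume "x \<in> ass R S" "y \<in> ass R S"
    then obtain s t where st: "x \<in> carrier R" "y \<in> carrier R" "s \<in> S" "t \<in> S"
      "s \<otimes> x = \<zero>" "t \<otimes> y = \<zero>" by (auto simp: ass_def)
    obtain v w where vw: "v \<in> S" "w \<in> carrier R" "v \<otimes> s = w \<otimes> t"
      using D st(3,4) Sc by blast
    have "v \<otimes> s \<otimes> x = \<zero>" using st vw(1) Sc by (simp add: m_assoc)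
    moreover have "v \<otimes> s \<otimes> y = \<zero>" unfolding vw(3) using st vw Sc by (simp add: m_assoc)
    ultimately have "v \<otimes> s \<otimes> (x \<oplus> y) = \<zero>" using st vw Sc by (simp add: r_distr)
    moreover have "v \<otimes> s \<in> S" using D st(3) vw(1) by blast
    ultimately show "x \<oplus> y \<in> ass R S" using st(1,2) unfolding ass_def by blast
  next
    fix r x assume r: "r \<in> carrier R" and "x \<in> ass R S"
    then obtain s where s: "x \<in> carrier R" "s \<in> S" "s \<otimes> x = \<zero>" by (auto simp: ass_def)
    obtain v w where vw: "v \<in> S" "w \<in> carrier R" "v \<otimes> r = w \<otimes> s" using D r s(2) by blast
    have "v \<otimes> (r \<otimes> x) = v \<otimes> r \<otimes> x" using r s(1) vw(1) Sc by (simp add: m_assoc)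
    also have "\<dots> = \<zero>" unfolding vw(3) using s vw Sc by (simp add: m_assoc)
    finally show "r \<otimes> x \<in> ass R S" using r s vw by (auto simp: ass_def)
  qed
  moreover have "x \<otimes> r \<in> ass R S" if "x \<in> ass R S" "r \<in> carrier R" for x r
    using that Sc by (auto simp: ass_def simp flip: m_assoc intro!: bexI)
  ultimately show ?thesis
    by (intro idealI) (auto simp: left_ideal_def ring_axioms additive_subgroup.a_subgroup)
qed

context semiprime_left_goldie
begin

text \<open>The set \<open>C + J\<close>, with \<open>C\<close> the regular elements and \<open>J\<close> the annihilator of \<open>I\<close>, consists of
  the elements of \<open>R\<close> that become invertible in the component of the quotient ring determined
  by \<open>I\<close>.\<close>

lemma ideal_meets_Den_l:
  assumes I: "ideal I R" "I \<noteq> {\<zero>}"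
  obtains S where "S \<in> Den_l R" "S \<inter> I \<noteq> {}"
proof -
  let ?C = "regular_elems R"
  define J where "J = left_ann R I"
  have Ic: "I \<subseteq> carrier R" using ideal.Icarr[OF I(1)] by blast
  have IL: "left_ideal I R"
    using I(1) ideal.I_l_closed ideal.axioms(1) by (auto simp: left_ideal_def)
  note ID = left_idealD[OF IL]
  have JL: "left_ideal J R" unfolding J_def using Ic by (rule left_ideal_left_ann)
  note JD = left_idealD[OF JL]
  have JI: "x \<otimes> y = \<zero>" if "x \<in> J" "y \<in> I" for x y
    using that by (simp add: J_def left_ann_def)
  have IJ: "y \<otimes> x = \<zero>" if "x \<in> J" "y \<in> I" for x y
  proof (rule semiprime_elem)
    have c: "x \<in> carrier R" "y \<in> carrier R" using that JD(1) Ic by blast+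
    show "y \<otimes> x \<in> carrier R" using c by simp
    fix r assume r: "r \<in> carrier R"
    have "x \<otimes> (r \<otimes> y) = \<zero>" using JI[OF that(1)] ID(5)[OF r that(2)] by blast
    then have "y \<otimes> (x \<otimes> (r \<otimes> y) \<otimes> x) = \<zero>" using c by simp
    then show "y \<otimes> x \<otimes> r \<otimes> (y \<otimes> x) = \<zero>" using c r by (simp add: m_assoc)
  qed
  \<comment> \<open>Semiprimeness makes the left and right annihilators of \<open>I\<close>
    coincide.\<close>
  have J_iff: "x \<in> J \<longleftrightarrow> (\<forall>y\<in>I. y \<otimes> x = \<zero>)" if x: "x \<in> carrier R" for x
  proof
    assume *: "\<forall>y\<in>I. y \<otimes> x = \<zero>"
    have "x \<otimes> y = \<zero>" if y: "y \<in> I" for y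
    proof (rule semiprime_elem)
      have yc: "y \<in> carrier R" using y Ic by blast
      then show "x \<otimes> y \<in> carrier R" using x by simp
      fix r assume r: "r \<in> carrier R"
      have "y \<otimes> r \<otimes> x = \<zero>" using * ideal.I_r_closed[OF I(1) y r] by blast
      then have "x \<otimes> (y \<otimes> r \<otimes> x) \<otimes> y = \<zero>" using x yc by simp
      then show "x \<otimes> y \<otimes> r \<otimes> (x \<otimes> y) = \<zero>" using x yc r by (simp add: m_assoc)
    qed
    then show "x \<in> J" using x by (simp add: J_def left_ann_def)
  qed (use IJ in blast)
  have J_r: "x \<otimes> r \<in> J" if "x \<in> J" "r \<in> carrier R" for x r
  proof -
    have xc: "x \<in> carrier R" using that JD(1) by blast
    have "y \<otimes> (x \<otimes> r) = \<zero>" if "y \<in> I" for y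
      using IJ[OF \<open>x \<in> J\<close> that] xc \<open>r \<in> carrier R\<close> that Ic by (auto simp flip: m_assoc)
    then show ?thesis using J_iff[of "x \<otimes> r"] xc that by simp
  qed
  let ?E = "set_add R I J"
  have E_iff: "x \<in> ?E \<longleftrightarrow> (\<exists>i\<in>I. \<exists>j\<in>J. x = i \<oplus> j)" for x by (auto simp: set_add_def')
  have "left_ideal ?E R"
  proof (rule left_idealI)
    show "?E \<subseteq> carrier R" using Ic JD(1) by (auto simp: E_iff subset_iff)
    show "\<zero> \<in> ?E" unfolding E_iff using ID(2) JD(2) by force
  next
    fix x y assume "x \<in> ?E" "y \<in> ?E"
    then obtain i j i' j' where ij: "i \<in> I" "j \<in> J" "i' \<in> I" "j' \<in> J" "x = i \<oplus> j" "y = i' \<oplus> j'"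
      unfolding E_iff by blast
    then have "i \<in> carrier R" "j \<in> carrier R" "i' \<in> carrier R" "j' \<in> carrier R"
      using Ic JD(1) by blast+
    then have "x \<oplus> y = (i \<oplus> i') \<oplus> (j \<oplus> j')" unfolding ij by (simp add: a_ac)
    then show "x \<oplus> y \<in> ?E" unfolding E_iff using ID(3) JD(3) ij by blast
  next
    fix r x assume r: "r \<in> carrier R" and "x \<in> ?E"
    then obtain i j where ij: "i \<in> I" "j \<in> J" "x = i \<oplus> j" unfolding E_iff by blast
    then have "r \<otimes> x = r \<otimes> i \<oplus> r \<otimes> j" using r Ic JD(1) by (simp add: r_distr subset_iff)
    then show "r \<otimes> x \<in> ?E" unfolding E_iff using ID(5) JD(5) ij r by blast
  qed
  \<comment> \<open>An element of \<open>K\<close> killed by \<open>I\<close> from the left lies in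
    \<open>J\<close>; any other has a nonzero multiple in both \<open>I\<close> and
    \<open>K\<close>.\<close>
  moreover have "\<exists>x\<in>?E \<inter> K. x \<noteq> \<zero>" if K: "left_ideal K R" "K \<noteq> {\<zero>}" for K
  proof -
    note KD = left_idealD[OF K(1)]
    obtain k where k: "k \<in> K" "k \<in> carrier R" "k \<noteq> \<zero>" using K by (rule left_ideal_nonzeroE)
    have IE: "i \<in> ?E" if "i \<in> I" for i
      unfolding E_iff using that JD(2) Ic by (intro bexI[of _ i] bexI[of _ \<zero>]) auto
    have JE: "j \<in> ?E" if "j \<in> J" for j
      unfolding E_iff using that ID(2) JD(1) by (intro bexI[of _ \<zero>] bexI[of _ j]) auto
    show ?thesis
    proof (cases "\<forall>y\<in>I. y \<otimes> k = \<zero>")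
      case True
      then show ?thesis using J_iff k JE by blast
    next
      case False
      then obtain y where "y \<in> I" "y \<otimes> k \<noteq> \<zero>" by blast
      moreover from this have "y \<otimes> k \<in> I" "y \<otimes> k \<in> K"
        using ideal.I_r_closed[OF I(1)] k KD(5) Ic by blast+
      ultimately show ?thesis using IE by blast
    qed
  qed
  ultimately have "essential ?E" by (rule essentialI)
  then obtain c0 where "c0 \<in> ?E" and c0: "c0 \<in> ?C" by (rule essential_contains_regular)
  then obtain i0 j0 where i0: "i0 \<in> I" "j0 \<in> J" "c0 = i0 \<oplus> j0" unfolding E_iff by blast
  have i0c: "i0 \<in> carrier R" "j0 \<in> carrier R" using i0 Ic JD(1) by blast+
  define S where "S = {c \<oplus> j | c j. c \<in> ?C \<and> j \<in> J}"
  have SI: "c \<oplus> j \<in> S" if "c \<in> ?C" "j \<in> J" for c j using that by (auto simp: S_def)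
  have SE: "\<exists>c j. c \<in> ?C \<and> j \<in> J \<and> c \<in> carrier R \<and> j \<in> carrier R \<and> s = c \<oplus> j" if "s \<in> S" for s
    using that regular_elems_closed JD(1) by (auto simp: S_def subset_iff)
  \<comment> \<open>The \<open>I\<close>-component of a regular element of \<open>I + J\<close> is
    the required common element of \<open>S\<close> and \<open>I\<close>.\<close>
  have "i0 = c0 \<oplus> \<ominus> j0" unfolding i0(3) using i0c by (simp add: a_assoc r_neg)
  then have i0S: "i0 \<in> S" using SI c0 JD(4)[OF i0(2)] by metis
  obtain y0 where y0: "y0 \<in> I" "y0 \<in> carrier R" "y0 \<noteq> \<zero>"
    using IL I(2) by (rule left_ideal_nonzeroE)
  have S_mult: "s \<otimes> t \<in> S" if st: "s \<in> S" "t \<in> S" for s t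
  proof -
    obtain c j where s: "c \<in> ?C" "j \<in> J" "c \<in> carrier R" "j \<in> carrier R" "s = c \<oplus> j"
      using SE[OF st(1)] by blast
    obtain d k where t: "d \<in> ?C" "k \<in> J" "d \<in> carrier R" "k \<in> carrier R" "t = d \<oplus> k"
      using SE[OF st(2)] by blast
    have "s \<otimes> t = c \<otimes> d \<oplus> (c \<otimes> k \<oplus> j \<otimes> (d \<oplus> k))"
      using s t by (simp add: l_distr r_distr a_ac)
    moreover have "c \<otimes> k \<oplus> j \<otimes> (d \<oplus> k) \<in> J" using JD(3,5) J_r s t by simp
    ultimately show ?thesis using SI[OF regular_elems_mult[OF s(1) t(1)]] by simp
  qed
  have "S \<in> Den_l R"
    unfolding Den_l_iff
  proof (intro conjI ballI impI)
    show "S \<subseteq> carrier R" using SE by fastforce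
    show "\<one> \<in> S" using SI[OF one_regular JD(2)] by simp
    show "\<zero> \<notin> S"
    proof
      assume "\<zero> \<in> S"
      then obtain c j where s: "c \<in> ?C" "j \<in> J" "c \<in> carrier R" "j \<in> carrier R" "\<zero> = c \<oplus> j"
        using SE by blast
      \<comment> \<open>Multiplying by a nonzero element of \<open>I\<close> removes the part in
        \<open>J\<close>; regularity of \<open>c\<close> then gives the contradiction.\<close>
      have "(c \<oplus> j) \<otimes> y0 = \<zero>" unfolding s(5)[symmetric] using y0(2) by (rule l_null)
      then have "c \<otimes> y0 = \<zero>" using s y0 JI by (simp add: l_distr)
      then show False using regular_elems_cancel(1)[OF s(1)] y0 by blast
    qed
  next
    fix s t assume "s \<in> S" "t \<in> S"
    then show "s \<otimes> t \<in> S" by (rule S_mult)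
  next
    fix r s assume r: "r \<in> carrier R" and "s \<in> S"
    then obtain c j where s: "c \<in> ?C" "j \<in> J" "c \<in> carrier R" "j \<in> carrier R" "s = c \<oplus> j"
      using SE by blast
    obtain v w where vw: "v \<in> ?C" "w \<in> carrier R" "v \<otimes> r = w \<otimes> c"
      by (rule regular_left_ore[OF r s(1)])
    have vc: "v \<in> carrier R" using vw(1) by (rule regular_elems_closed)
    have "v \<oplus> \<zero> \<in> S" using SI[OF vw(1) JD(2)] .
    \<comment> \<open>The factor \<open>i0\<close> annihilates \<open>w j\<close>, so the Ore
      relation for the regular part \<open>c\<close> becomes one for
      \<open>s = c \<oplus> j\<close>.\<close>
    then have "i0 \<otimes> v \<in> S" using S_mult[OF i0S] vc by simp
    moreover have "i0 \<otimes> v \<otimes> r = i0 \<otimes> w \<otimes> s"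
    proof -
      have "i0 \<otimes> w \<otimes> j = \<zero>" using IJ[OF JD(5)[OF vw(2) s(2)] i0(1)] i0c vw(2) s by (simp add: m_assoc)
      then have "i0 \<otimes> w \<otimes> s = i0 \<otimes> w \<otimes> c" using s i0c vw(2) by (simp add: r_distr)
      then show ?thesis using vw vc i0c r s by (simp add: m_assoc)
    qed
    ultimately show "\<exists>s'\<in>S. \<exists>r'\<in>carrier R. s' \<otimes> r = r' \<otimes> s"
      using i0c(1) vw(2) by blast
    assume z: "r \<otimes> s = \<zero>"
    \<comment> \<open>Modulo \<open>J\<close> the element \<open>s\<close> acts as the regular
      \<open>c\<close>, so \<open>r\<close> vanishes there; \<open>i0\<close> then serves as the
      left annihilating element.\<close>
    have "r \<in> J"
      unfolding J_iff[OF r]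
    proof
      fix y assume y: "y \<in> I"
      then have yc: "y \<in> carrier R" using Ic by blast
      have "y \<otimes> (r \<otimes> (c \<oplus> j)) = \<zero>" using z s yc by simp
      then have "y \<otimes> r \<otimes> c \<oplus> y \<otimes> (r \<otimes> j) = \<zero>" using r s yc by (simp add: r_distr m_assoc)
      then have "y \<otimes> r \<otimes> c = \<zero>" using IJ[OF JD(5)[OF r s(2)] y] r s yc by simp
      then show "y \<otimes> r = \<zero>" using regular_elems_cancel(2)[OF s(1)] r yc by simp
    qed
    then have "i0 \<otimes> r = \<zero>" using IJ i0(1) by blast
    then show "\<exists>t\<in>S. t \<otimes> r = \<zero>" using i0S by blast
  qed
  then show ?thesis using that i0S i0(1) by blast
qed

theorem T_l_eq_regular:
  assumes one: "\<one> \<noteq> \<zero>"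
  shows "T_l R = regular_elems R"
proof
  have C: "regular_elems R \<in> Den_l R" using one by (rule regular_Den_l)
  then have "regular_elems R \<subseteq> L_s_l R"
    using regular_subset_max_Den_l by (auto simp: L_s_l_def)
  then show "regular_elems R \<subseteq> T_l R" using C by (auto simp: T_l_def)
  have T: "T_l R \<in> Den_l R" using one by (rule T_l_Den_l)
  have "ass R (T_l R) = {\<zero>}"
  proof (rule ccontr)
    assume "ass R (T_l R) \<noteq> {\<zero>}"
    then obtain S where S: "S \<in> Den_l R" "S \<inter> ass R (T_l R) \<noteq> {}"
      by (rule ideal_meets_Den_l[OF ass_ideal[OF T]])
    then obtain i t where i: "i \<in> S" "t \<in> T_l R" "t \<otimes> i = \<zero>" by (auto simp: ass_def)
    obtain M where M: "M \<in> max_Den_l R" "S \<subseteq> M" using S(1) by (rule ex_max_Den_l)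
    have "t \<in> M" using i(2) M(1) by (auto simp: T_l_def L_s_l_def)
    moreover have "i \<in> M" "M \<in> Den_l R" using i(1) M by (auto simp: max_Den_l_def)
    ultimately have "t \<otimes> i \<in> M" "\<zero> \<notin> M" by (simp_all add: Den_l_iff)
    then show False using i(3) by simp
  qed
  then have z: "r = \<zero>" if "r \<in> carrier R" "t \<in> T_l R" "t \<otimes> r = \<zero>" for r t
    using that unfolding ass_def by blast
  \<comment> \<open>The denominator condition turns a zero product on the right into one on the
    left, which is already excluded.\<close>
  have "r = \<zero>" if "r \<in> carrier R" "t \<in> T_l R" "r \<otimes> t = \<zero>" for r t
  proof -
    have "\<exists>u\<in>T_l R. u \<otimes> r = \<zero>" using T that unfolding Den_l_iff by blast
    then show ?thesis using z that(1) by blast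
  qed
  moreover have "t \<in> carrier R" if "t \<in> T_l R" for t
    using T that unfolding Den_l_iff by blast
  ultimately show "T_l R \<subseteq> regular_elems R"
    using z by (intro subsetI regular_elemsI) blast+
qed

end

theorem theorem5p1:
  fixes R (structure)
  assumes "ring R" and "\<one> \<noteq> \<zero>"
    and "semiprime_ring R" and "left_goldie R"
  shows "Q_l_s R = Q_l_cl R \<and> l_s R = {\<zero>} \<and> T_l R = regular_elems R"
proof -
  interpret semiprime_left_goldie R
    using assms by (intro semiprime_left_goldie.intro semiprime_left_goldie_axioms.intro)
  have T: "T_l R = regular_elems R" using assms(2) by (rule T_l_eq_regular)
  have "ass R (regular_elems R) = {\<zero>}"
    using one_regular
    by (auto simp: ass_def dest: regular_elems_cancel(1) intro!: bexI[of _ \<one>])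
  then show ?thesis using T by (simp add: Q_l_s_def Q_l_cl_def l_s_def)
qed

end
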